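(* Let $G$ be a countable ICC group and let $\pi:G\to\mathcal U(\mathcal H)$ be a unitary representation of $G$ on the Hilbert space $\mathcal H$. Suppose $\xi\in\mathcal H$ is a Parseval frame vector for $\mathcal H$ with $\|\xi\|^2=\frac1N$ for some $N\in\mathbb N$. Assume in addition that there exists an ICC subgroup $H$ of $G$ of index $[G:H]=N$. Then there exists a Parseval frame vector $\eta$ for $\mathcal H$ with the property that $\{\sqrt N\,\pi(h)\eta\,|\,h\in H\}$ is an orthonormal basis for $\mathcal H$.
   Context: A group $G$ is ICC if for every $g\ne e$ in $G$ the conjugacy class of $g$ is infinite. A family $\{e_i\,|\,i\in I\}$ in a Hilbert space $\mathcal H$ is a Parseval frame for $\mathcal H$ if $\|f\|^2=\sum_{i\in I}|\langle f,e_i\rangle|^2$ for all $f\in\mathcal H$. A vector $\xi\in\mathcal H$ is a Parseval frame vector for $\mathcal H$ (with the representation $\pi$ of $G$) if $\{\pi(g)\xi\,|\,g\in G\}$ (indexed by $G$) is a Parseval frame for $\mathcal H$. *)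

theory Defs
  imports "HOL-Analysis.Analysis" "HOL-Algebra.Coset"
begin

section \<open>Complex Hilbert spaces\<close>

text \<open>The inner product is linear in the first argument. The norm, and hence the topology and
  completeness, are those of the underlying real normed vector space; the last axiom says that this
  norm is the one induced by the inner product.\<close>

class complex_inner = real_normed_vector +
  fixes scaleC :: "complex \<Rightarrow> 'a \<Rightarrow> 'a" (infixr "*\<^sub>C" 75)
    and cinner :: "'a \<Rightarrow> 'a \<Rightarrow> complex"
  assumes scaleC_add_right: "a *\<^sub>C (x + y) = a *\<^sub>C x + a *\<^sub>C y"
    and scaleC_add_left: "(a + b) *\<^sub>C x = a *\<^sub>C x + b *\<^sub>C x"
    and scaleC_scaleC: "a *\<^sub>C (b *\<^sub>C x) = (a * b) *\<^sub>C x"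
    and scaleC_one: "1 *\<^sub>C x = x"
    and scaleR_scaleC: "r *\<^sub>R x = complex_of_real r *\<^sub>C x"
    and cinner_commute: "cinner x y = cnj (cinner y x)"
    and cinner_add_left: "cinner (x + y) z = cinner x z + cinner y z"
    and cinner_scaleC_left: "cinner (a *\<^sub>C x) y = a * cinner x y"
    and cinner_self: "cinner x x = complex_of_real ((norm x)\<^sup>2)"

class chilbert_space = complex_inner + complete_space

global_interpretation complex_vector:
  vector_space "scaleC :: complex \<Rightarrow> 'a \<Rightarrow> 'a::complex_inner"
  defines cspan = complex_vector.span
  by unfold_locales
    (simp_all add: scaleC_add_right scaleC_add_left scaleC_scaleC scaleC_one)

instantiation complex :: chilbert_space
begin

definition scaleC_complex :: "complex \<Rightarrow> complex \<Rightarrow> complex" where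
  "scaleC_complex a x = a * x"

definition cinner_complex :: "complex \<Rightarrow> complex \<Rightarrow> complex" where
  "cinner_complex x y = x * cnj y"

instance
proof
  fix x :: complex
  show "cinner x x = complex_of_real ((norm x)\<^sup>2)"
    unfolding cinner_complex_def by (rule complex_norm_square [symmetric])
qed (simp_all add: scaleC_complex_def cinner_complex_def algebra_simps scaleR_conv_of_real)

end

definition orthonormal_basis :: "('i \<Rightarrow> 'h::chilbert_space) \<Rightarrow> 'i set \<Rightarrow> bool" where
  "orthonormal_basis e I \<longleftrightarrow>
     (\<forall>i\<in>I. \<forall>j\<in>I. cinner (e i) (e j) = (if i = j then 1 else 0)) \<and>
     closure (cspan (e ` I)) = UNIV"

definition parseval_frame :: "('i \<Rightarrow> 'h::chilbert_space) \<Rightarrow> 'i set \<Rightarrow> bool" where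
  "parseval_frame e I \<longleftrightarrow>
     (\<forall>f. ((\<lambda>i. (cmod (cinner f (e i)))\<^sup>2) has_sum (norm f)\<^sup>2) I)"


section \<open>Unitary representations\<close>

definition unitary_op :: "('h::chilbert_space \<Rightarrow> 'h) \<Rightarrow> bool" where
  "unitary_op U \<longleftrightarrow> Vector_Spaces.linear scaleC scaleC U \<and>
     (\<forall>x y. cinner (U x) (U y) = cinner x y) \<and> surj U"

definition unitary_group :: "('h::chilbert_space \<Rightarrow> 'h) monoid" where
  "unitary_group = \<lparr>carrier = {U. unitary_op U}, mult = (\<circ>), one = id\<rparr>"

definition unitary_representation ::
    "('g, 'b) monoid_scheme \<Rightarrow> ('g \<Rightarrow> 'h::chilbert_space \<Rightarrow> 'h) \<Rightarrow> bool" where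
  "unitary_representation G \<pi> \<longleftrightarrow> \<pi> \<in> hom G unitary_group"

definition parseval_frame_vector ::
    "('g, 'b) monoid_scheme \<Rightarrow> ('g \<Rightarrow> 'h::chilbert_space \<Rightarrow> 'h) \<Rightarrow> 'h \<Rightarrow> bool" where
  "parseval_frame_vector G \<pi> \<xi> \<longleftrightarrow> parseval_frame (\<lambda>g. \<pi> g \<xi>) (carrier G)"


section \<open>ICC groups\<close>

definition conjugacy_class :: "('g, 'b) monoid_scheme \<Rightarrow> 'g \<Rightarrow> 'g set" where
  "conjugacy_class G g = (\<lambda>x. x \<otimes>\<^bsub>G\<^esub> g \<otimes>\<^bsub>G\<^esub> inv\<^bsub>G\<^esub> x) ` carrier G"

definition icc_group :: "('g, 'b) monoid_scheme \<Rightarrow> bool" where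
  "icc_group G \<longleftrightarrow> group G \<and>
     (\<forall>g\<in>carrier G. g \<noteq> \<one>\<^bsub>G\<^esub> \<longrightarrow> infinite (conjugacy_class G g))"

lemma inj_unitary_op:
  assumes "unitary_op U"
  shows "inj U"
proof (rule injI)
  fix x y assume eq: "U x = U y"
  interpret Vector_Spaces.linear scaleC scaleC U
    using assms by (simp add: unitary_op_def)
  have "cinner (x - y) (x - y) = cinner (U (x - y)) (U (x - y))"
    using assms by (simp add: unitary_op_def)
  also have "U (x - y) = 0"
    using eq by (simp add: diff)
  finally show "x = y"
    by (simp add: cinner_self)
qed

lemma group_unitary_group: "group (unitary_group :: ('h::chilbert_space \<Rightarrow> 'h) monoid)"
proof (rule groupI)
  fix U V :: "'h \<Rightarrow> 'h"
  assume UV: "U \<in> carrier unitary_group" "V \<in> carrier unitary_group"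
  then have "unitary_op (U \<circ> V)"
    unfolding unitary_op_def unitary_group_def
    using Vector_Spaces.linear_compose[of scaleC scaleC V scaleC U] comp_surj[of V U] by simp
  then show "U \<otimes>\<^bsub>unitary_group\<^esub> V \<in> carrier unitary_group"
    by (simp add: unitary_group_def)
next
  show "\<one>\<^bsub>unitary_group\<^esub> \<in> carrier (unitary_group :: ('h \<Rightarrow> 'h) monoid)"
    by (simp add: unitary_group_def unitary_op_def complex_vector.linear_id)
next
  fix U :: "'h \<Rightarrow> 'h"
  assume "U \<in> carrier unitary_group"
  then have U: "unitary_op U" by (simp add: unitary_group_def)
  then have lin: "Vector_Spaces.linear scaleC scaleC U" and s: "surj U"
    and c: "\<And>x y. cinner (U x) (U y) = cinner x y" by (simp_all add: unitary_op_def)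
  note i = inj_unitary_op[OF U]
  interpret Vector_Spaces.linear scaleC scaleC U by (rule lin)
  have f: "U (inv_into UNIV U x) = x" for x using s by (simp add: surj_f_inv_f)
  have "Vector_Spaces.linear scaleC scaleC (inv_into UNIV U)"
    unfolding Vector_Spaces.linear_iff
  proof (intro conjI allI)
    show "inv_into UNIV U (x + y) = inv_into UNIV U x + inv_into UNIV U y" for x y
      by (rule injD[OF i]) (simp add: f add)
    show "inv_into UNIV U (a *\<^sub>C x) = a *\<^sub>C inv_into UNIV U x" for a x
      by (rule injD[OF i]) (simp add: f scale)
  qed (rule complex_vector.vector_space_axioms)+
  moreover have "cinner (inv_into UNIV U x) (inv_into UNIV U y) = cinner x y" for x y
    using c[of "inv_into UNIV U x" "inv_into UNIV U y"] by (simp add: f)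
  ultimately have "unitary_op (inv_into UNIV U)"
    using i by (simp add: unitary_op_def inj_imp_surj_inv)
  moreover have "inv_into UNIV U \<circ> U = id" using i by simp
  ultimately show "\<exists>V\<in>carrier unitary_group. V \<otimes>\<^bsub>unitary_group\<^esub> U = \<one>\<^bsub>unitary_group\<^esub>"
    by (auto simp: unitary_group_def)
qed (auto simp: unitary_group_def)

end

theory Submission
  imports Defs
begin

text \<open>
  Let \<open>K\<close> be the Hilbert space of the representation. If \<open>\<eta>\<close> is a unit vector whose orbit
  \<open>{\<pi> h \<eta> | h \<in> H}\<close> is an orthonormal basis of \<open>K\<close>, then \<open>\<eta> / sqrt N\<close> is the vector
  required: the sum of the squared coefficients over \<open>G\<close> splits into \<open>N\<close> sums over cosets of
  \<open>H\<close>, and Parseval's identity gives \<open>(norm f)\<^sup>2 / N\<close> for each of them. So the point is that the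
  restriction of \<open>\<pi>\<close> to \<open>H\<close> is equivalent to the regular representation of \<open>H\<close>. The classical
  reason is that \<open>K\<close> has dimension \<open>N * (1 / N) = 1\<close> over the von Neumann algebra of \<open>H\<close>,
  which is a finite factor because \<open>H\<close> is ICC. The proof below is a direct version of this
  argument that uses vectors of \<open>K\<close> in place of operators on \<open>l\<^sup>2(H)\<close>.

  Call \<open>u\<close> a Bessel vector if \<open>f \<mapsto> (\<langle>f, \<pi> h u\<rangle>)\<^sub>h\<close> is a contraction from \<open>K\<close> to
  \<open>l\<^sup>2(H)\<close>. These vectors form a closed bounded convex set, and this set has an extreme point
  \<open>\<eta>\<close> (\<open>exists_extreme_bessel\<close>). Let \<open>A f = (\<Sum>h. \<langle>f, \<pi> h \<eta>\<rangle> \<pi> h \<eta>)\<close>. Extremality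
  is used twice.

  \<^item> Moving \<open>\<eta>\<close> by a small multiple of \<open>\<eta> - A \<eta>\<close>, in either direction, gives Bessel vectors,
    so \<open>A \<eta> = \<eta>\<close> and \<open>A\<close> is the projection onto the closed span of the orbit of \<open>\<eta>\<close>
    (\<open>extreme_bessel_fixed\<close>).

  \<^item> Let \<open>y\<close> be a Bessel vector with \<open>A y = 0\<close>, and let \<open>w = (\<Sum>h. a h \<pi> h y)\<close> with
    \<open>a h = \<langle>\<eta>, \<pi> h \<eta>\<rangle>\<close>. Then \<open>y - w\<close> is orthogonal to the orbit of \<open>\<eta>\<close>, and its coefficient
    sequences are orthogonal to those of \<open>\<eta>\<close>, so \<open>\<eta>\<close> could be moved along it; hence
    \<open>y = w\<close> (\<open>extreme_bessel_rigid\<close>).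

  The second fact also applies to every \<open>\<pi> k y\<close> and yields \<open>y = (\<Sum>h. a (k h k\<^sup>-\<^sup>1) \<pi> h y)\<close> for
  all \<open>k \<in> H\<close>. As \<open>H\<close> is ICC, suitable averages over \<open>k\<close> make all coefficients with \<open>h \<noteq> 1\<close>
  disappear in \<open>l\<^sup>2(H)\<close> (\<open>icc_average\<close>), which leaves \<open>y = (norm \<eta>)\<^sup>2 y\<close>. So either
  \<open>norm \<eta> = 1\<close> or the kernel of \<open>A\<close> contains no Bessel vector other than \<open>0\<close>
  (\<open>extreme_bessel_alternative\<close>).

  It remains to count dimensions (\<open>extreme_bessel_complete\<close>). The vectors \<open>x = \<pi> r \<xi>\<close>, for
  representatives \<open>r\<close> of the \<open>N\<close> right cosets of \<open>H\<close>, are Bessel vectors, their \<open>H\<close>-orbits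
  together are a Parseval frame, and \<open>(\<Sum>x. (norm x)\<^sup>2) = 1\<close>. Expanding \<open>(norm \<eta>)\<^sup>2\<close> in this
  frame gives \<open>(norm \<eta>)\<^sup>2 = (\<Sum>x. \<langle>A x, x\<rangle>) = 1 - (\<Sum>x. (norm (x - A x))\<^sup>2)\<close>. Half of
  \<open>x - A x\<close> is a Bessel vector in the kernel of \<open>A\<close>, so in both cases of the alternative
  \<open>norm \<eta> = 1\<close> and \<open>A x = x\<close> for all \<open>x\<close>. Therefore \<open>A\<close> is the identity, and the orbit of
  \<open>\<eta>\<close> is an orthonormal basis.
\<close>

section \<open>Complex inner product spaces\<close>

instance chilbert_space \<subseteq> banach ..

lemma cinner_add_right: "cinner x (y + z) = cinner x y + cinner x z"
  by (subst (1 2 3) cinner_commute) (simp add: cinner_add_left)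

lemma cinner_scaleC_right: "cinner x (a *\<^sub>C y) = cnj a * cinner x y"
  by (subst (1 2) cinner_commute) (simp add: cinner_scaleC_left)

lemma cinner_minus_left: "cinner (- x) y = - cinner x y"
  using cinner_scaleC_left[of "-1" x y] by simp

lemma cinner_minus_right: "cinner x (- y) = - cinner x y"
  using cinner_scaleC_right[of x "-1" y] by simp

lemma cinner_diff_left: "cinner (x - y) z = cinner x z - cinner y z"
  using cinner_add_left[of x "- y" z] by (simp add: cinner_minus_left)

lemma cinner_diff_right: "cinner x (y - z) = cinner x y - cinner x z"
  using cinner_add_right[of x y "- z"] by (simp add: cinner_minus_right)

lemma cinner_scaleR_left: "cinner (r *\<^sub>R x) y = of_real r * cinner x y"
  by (simp add: scaleR_scaleC cinner_scaleC_left)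

lemma cinner_scaleR_right: "cinner x (r *\<^sub>R y) = of_real r * cinner x y"
  by (simp add: scaleR_scaleC cinner_scaleC_right)

lemma cinner_zero_left [simp]: "cinner 0 y = 0"
  using cinner_diff_left[of 0 0 y] by simp

lemma cinner_zero_right [simp]: "cinner x 0 = 0"
  using cinner_diff_right[of x 0 0] by simp

lemmas cinner_simps = cinner_add_left cinner_add_right cinner_diff_left cinner_diff_right
  cinner_minus_left cinner_minus_right cinner_scaleR_left cinner_scaleR_right
  cinner_scaleC_left cinner_scaleC_right

lemma cinner_sum_left: "cinner (sum f A) y = (\<Sum>i\<in>A. cinner (f i) y)"
  by (induction A rule: infinite_finite_induct) (simp_all add: cinner_add_left)

lemma norm_sq_eq_Re_cinner: "(norm x)\<^sup>2 = Re (cinner x x)"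
  by (simp add: cinner_self)

lemma cinner_eq_zero_iff: "cinner x x = 0 \<longleftrightarrow> x = 0"
  by (simp add: cinner_self)

lemma Re_cinner_commute: "Re (cinner x y) = Re (cinner y x)"
  by (subst cinner_commute) simp

lemma cinner_eqI:
  assumes "\<And>f. cinner x f = cinner y f"
  shows "x = y"
proof -
  have "cinner (x - y) (x - y) = 0"
    using assms by (simp add: cinner_simps)
  then show ?thesis
    by (simp add: cinner_eq_zero_iff)
qed

lemma norm_add_sq: "(norm (x + y))\<^sup>2 = (norm x)\<^sup>2 + (norm y)\<^sup>2 + 2 * Re (cinner x y)"
  using Re_cinner_commute[of x y] by (simp add: norm_sq_eq_Re_cinner cinner_simps)

lemma norm_diff_sq: "(norm (x - y))\<^sup>2 = (norm x)\<^sup>2 + (norm y)\<^sup>2 - 2 * Re (cinner x y)"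
  using Re_cinner_commute[of x y] by (simp add: norm_sq_eq_Re_cinner cinner_simps)

lemma parallelogram: "(norm (x + y))\<^sup>2 + (norm (x - y))\<^sup>2 = 2 * (norm x)\<^sup>2 + 2 * (norm y)\<^sup>2"
  for x y :: "'a::complex_inner"
  by (simp add: norm_add_sq norm_diff_sq)

lemma norm_scaleC: "norm (a *\<^sub>C x) = cmod a * norm x"
proof (rule power2_eq_imp_eq)
  have "complex_of_real ((norm (a *\<^sub>C x))\<^sup>2) = a * cnj a * complex_of_real ((norm x)\<^sup>2)"
    unfolding cinner_self[symmetric] by (simp add: cinner_scaleC_left cinner_scaleC_right)
  also have "\<dots> = complex_of_real ((cmod a * norm x)\<^sup>2)"
    by (simp add: power_mult_distrib complex_norm_square[symmetric] del: of_real_power)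
  finally have "complex_of_real ((norm (a *\<^sub>C x))\<^sup>2) = complex_of_real ((cmod a * norm x)\<^sup>2)" .
  then show "(norm (a *\<^sub>C x))\<^sup>2 = (cmod a * norm x)\<^sup>2"
    by (simp only: of_real_eq_iff)
qed simp_all

lemma Cauchy_Schwarz_cinner: "cmod (cinner x y) \<le> norm x * norm y"
proof (cases "y = 0")
  case False
  define c where "c = cinner x y / of_real ((norm y)\<^sup>2)"
  have ny: "(norm y)\<^sup>2 > 0"
    using False by simp
  have "0 \<le> (norm (x - c *\<^sub>C y))\<^sup>2"
    by simp
  also have "\<dots> = (norm x)\<^sup>2 + (cmod c)\<^sup>2 * (norm y)\<^sup>2 - 2 * Re (cnj c * cinner x y)"
    by (simp add: norm_diff_sq norm_scaleC power_mult_distrib cinner_simps)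
  also have "cnj c * cinner x y = of_real ((cmod (cinner x y))\<^sup>2 / (norm y)\<^sup>2)"
    unfolding c_def by (simp add: complex_norm_square mult.commute del: of_real_power)
  also have "Re (of_real ((cmod (cinner x y))\<^sup>2 / (norm y)\<^sup>2)) = (cmod (cinner x y))\<^sup>2 / (norm y)\<^sup>2"
    by (rule Re_complex_of_real)
  also have "(cmod c)\<^sup>2 * (norm y)\<^sup>2 = (cmod (cinner x y))\<^sup>2 / (norm y)\<^sup>2"
    using ny by (simp add: c_def norm_divide norm_power power_divide field_simps flip: power_mult power_add)
  finally have "(cmod (cinner x y))\<^sup>2 \<le> (norm x * norm y)\<^sup>2"
    using ny by (simp add: field_simps power_mult_distrib)
  then show ?thesis
    by (rule power2_le_imp_le) simp
qed simp

lemma bounded_linear_cinner_left: "bounded_linear (\<lambda>x. cinner x y)"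
  by (rule bounded_linear_intro[where K = "norm y"])
    (simp_all add: cinner_simps Cauchy_Schwarz_cinner scaleR_conv_of_real)

lemma bounded_linear_cinner_right: "bounded_linear (\<lambda>y. cinner x y)"
  by (rule bounded_linear_intro[where K = "norm x"])
    (use Cauchy_Schwarz_cinner[of x] in \<open>simp_all add: cinner_simps scaleR_conv_of_real mult.commute\<close>)

section \<open>Extreme points of closed convex sets\<close>

text \<open>This replaces weak compactness of bounded closed convex sets. The infima of the norm over the sets
  increase and are bounded, so they converge. Almost norm-minimal points of the sets then form a
  Cauchy sequence by the parallelogram law: the midpoint of two of them lies in the larger of their
  sets, so it cannot be much shorter than they are.\<close>

lemma nested_closed_midpoint_convex_nonempty:
  fixes C :: "nat \<Rightarrow> 'h::chilbert_space set"
  assumes closed: "\<And>n. closed (C n)" and nonempty: "\<And>n. C n \<noteq> {}"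
    and decr: "\<And>m n. m \<le> n \<Longrightarrow> C n \<subseteq> C m"
    and midpoint: "\<And>n x y. x \<in> C n \<Longrightarrow> y \<in> C n \<Longrightarrow> (1/2) *\<^sub>R (x + y) \<in> C n"
    and bounded: "bounded (C 0)"
  shows "\<exists>x. \<forall>n. x \<in> C n"
proof -
  define d where "d n = Inf ((\<lambda>x. (norm x)\<^sup>2) ` C n)" for n
  have bdd: "bdd_below ((\<lambda>x. (norm x)\<^sup>2) ` C n)" for n
    by (rule bdd_belowI[where m = 0]) auto
  have d_le: "d n \<le> (norm x)\<^sup>2" if "x \<in> C n" for n x
    unfolding d_def using that by (intro cInf_lower bdd) auto
  have "\<exists>x. x \<in> C n \<and> (norm x)\<^sup>2 < d n + 1 / Suc n" for n
  proof -
    have "\<exists>r\<in>(\<lambda>x. (norm x)\<^sup>2) ` C n. r < d n + 1 / Suc n"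
      using nonempty[of n] unfolding d_def by (intro cInf_lessD) auto
    then show ?thesis by auto
  qed
  then obtain x where x: "\<And>n. x n \<in> C n" "\<And>n. (norm (x n))\<^sup>2 < d n + 1 / Suc n"
    by metis
  have "incseq d"
    unfolding d_def incseq_def using decr nonempty
    by (auto intro!: cInf_superset_mono bdd)
  obtain R where R: "\<And>y. y \<in> C 0 \<Longrightarrow> norm y \<le> R"
    using bounded by (auto simp: bounded_iff)
  have "d n \<le> R\<^sup>2" for n
  proof -
    have "x n \<in> C 0" using decr[of 0 n] x(1)[of n] by auto
    then have "(norm (x n))\<^sup>2 \<le> R\<^sup>2" by (intro power_mono R) auto
    then show ?thesis using d_le[OF x(1)] order_trans by blast
  qed
  then obtain D where D: "d \<longlonglongrightarrow> D" "\<And>n. d n \<le> D"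
    using incseq_convergent[OF \<open>incseq d\<close>] by blast
  \<comment> \<open>The midpoint of \<open>x m\<close> and \<open>x n\<close> is in \<open>C k\<close>, hence at least as long as \<open>sqrt (d k)\<close>.\<close>
  have close: "(norm (x m - x n))\<^sup>2 \<le> 4 * (D - d k) + 4 / Suc k" if "k \<le> m" "k \<le> n" for k m n
  proof -
    have "(1/2) *\<^sub>R (x m + x n) \<in> C k"
      using decr[OF that(1)] decr[OF that(2)] x(1) by (intro midpoint) auto
    then have "d k \<le> (norm (x m + x n))\<^sup>2 / 4"
      using d_le by (fastforce simp: power_mult_distrib power2_eq_square)
    moreover have "(norm (x l))\<^sup>2 \<le> D + 1 / Suc k" if "k \<le> l" for l
    proof -
      have "(1::real) / Suc l \<le> 1 / Suc k" using that by (simp add: frac_le)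
      then show ?thesis using x(2)[of l] D(2)[of l] by linarith
    qed
    from this[OF that(1)] this[OF that(2)]
    have "(norm (x m))\<^sup>2 + (norm (x n))\<^sup>2 \<le> 2 * D + 2 * (1 / Suc k)" by linarith
    ultimately show ?thesis
      using parallelogram[of "x m" "x n"] by simp
  qed
  have "(\<lambda>k. 4 * (D - d k) + 4 / Suc k) \<longlonglongrightarrow> 4 * (D - D) + 0"
    by (intro tendsto_intros D LIMSEQ_Suc[OF lim_const_over_n])
  then have lim: "(\<lambda>k. 4 * (D - d k) + 4 / Suc k) \<longlonglongrightarrow> 0" by simp
  have "Cauchy x"
  proof (rule metric_CauchyI)
    fix e :: real assume "e > 0"
    then have "\<forall>\<^sub>F k in sequentially. 4 * (D - d k) + 4 / Suc k < e\<^sup>2"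
      by (intro order_tendstoD(2)[OF lim]) simp
    then obtain k where k: "4 * (D - d k) + 4 / Suc k < e\<^sup>2"
      by (auto simp: eventually_sequentially)
    have "dist (x m) (x n) < e" if "k \<le> m" "k \<le> n" for m n
      using close[OF that] k \<open>e > 0\<close>
      by (intro power2_less_imp_less[of _ e]) (auto simp: dist_norm)
    then show "\<exists>M. \<forall>m\<ge>M. \<forall>n\<ge>M. dist (x m) (x n) < e" by blast
  qed
  then obtain l where l: "x \<longlonglongrightarrow> l"
    using Cauchy_convergent convergent_def by blast
  have "l \<in> C n" for n
  proof (rule closed_sequentially[OF closed])
    show "(\<lambda>k. x (k + n)) \<longlonglongrightarrow> l" using l by (rule LIMSEQ_ignore_initial_segment)
    show "x (k + n) \<in> C n" for k using decr[of n "k + n"] x(1)[of "k + n"] by auto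
  qed
  then show ?thesis by blast
qed

definition face :: "'h::complex_inner \<Rightarrow> 'h set \<Rightarrow> 'h set" where
  "face v C = {x \<in> C. \<forall>y\<in>C. Re (cinner y v) \<le> Re (cinner x v)}"

lemma face_subset: "face v C \<subseteq> C"
  by (auto simp: face_def)

lemma closed_Re_cinner_ge: "closed {x. a \<le> Re (cinner x v)}"
  by (rule closed_Collect_le[OF continuous_on_const])
    (rule continuous_on_Re[OF linear_continuous_on[OF bounded_linear_cinner_left]])

lemma closed_face:
  assumes "closed C"
  shows "closed (face v C)"
proof -
  have "face v C = C \<inter> (\<Inter>y\<in>C. {x. Re (cinner y v) \<le> Re (cinner x v)})"
    by (auto simp: face_def)
  then show ?thesis
    using assms by (auto intro!: closed_Re_cinner_ge closed_INT)
qed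

lemma face_midpoint:
  assumes "\<And>x y. x \<in> C \<Longrightarrow> y \<in> C \<Longrightarrow> (1/2) *\<^sub>R (x + y) \<in> C" "x \<in> face v C" "y \<in> face v C"
  shows "(1/2) *\<^sub>R (x + y) \<in> face v C"
proof -
  have "Re (cinner x v) = Re (cinner y v)"
    using assms(2,3) by (intro antisym) (auto simp: face_def)
  then show ?thesis
    using assms by (auto simp: face_def cinner_simps)
qed

text \<open>The points where the functional is within \<open>1 / Suc n\<close> of its supremum form a decreasing sequence
  of nonempty closed convex sets, and a common point of them attains the supremum.\<close>

lemma face_nonempty:
  fixes C :: "'h::chilbert_space set"
  assumes C: "closed C" "C \<noteq> {}" "bounded C"
    and mid: "\<And>x y. x \<in> C \<Longrightarrow> y \<in> C \<Longrightarrow> (1/2) *\<^sub>R (x + y) \<in> C"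
  shows "face v C \<noteq> {}"
proof -
  define s where "s = Sup ((\<lambda>x. Re (cinner x v)) ` C)"
  obtain R where R: "\<And>y. y \<in> C \<Longrightarrow> norm y \<le> R"
    using C(3) by (auto simp: bounded_iff)
  have bdd: "bdd_above ((\<lambda>x. Re (cinner x v)) ` C)"
  proof (rule bdd_aboveI2)
    fix x assume "x \<in> C"
    have "Re (cinner x v) \<le> norm x * norm v"
      using complex_Re_le_cmod Cauchy_Schwarz_cinner order_trans by blast
    also have "\<dots> \<le> R * norm v" using R[OF \<open>x \<in> C\<close>] by (intro mult_right_mono) auto
    finally show "Re (cinner x v) \<le> R * norm v" .
  qed
  have le_s: "Re (cinner x v) \<le> s" if "x \<in> C" for x
    unfolding s_def using that by (intro cSup_upper bdd) auto
  define D where "D n = C \<inter> {x. s - 1 / Suc n \<le> Re (cinner x v)}" for n :: nat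
  have "\<exists>x. \<forall>n. x \<in> D n"
  proof (rule nested_closed_midpoint_convex_nonempty)
    show "closed (D n)" for n
      unfolding D_def by (intro closed_Int C closed_Re_cinner_ge)
    show "D n \<noteq> {}" for n
    proof -
      have "\<exists>r\<in>(\<lambda>x. Re (cinner x v)) ` C. s - 1 / Suc n < r"
        using C(2) unfolding s_def by (intro less_cSupD) auto
      then show ?thesis by (auto simp: D_def intro: less_imp_le)
    qed
    show "D n \<subseteq> D m" if "m \<le> n" for m n
    proof -
      have "(1::real) / Suc n \<le> 1 / Suc m" using that by (simp add: frac_le)
      then show ?thesis by (auto simp: D_def)
    qed
    show "bounded (D 0)" unfolding D_def using C(3) by (rule bounded_subset) auto
    show "(1/2) *\<^sub>R (x + y) \<in> D n" if "x \<in> D n" "y \<in> D n" for n x y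
      using that mid[of x y] by (auto simp: D_def cinner_simps)
  qed
  then obtain x where x: "x \<in> D n" for n by blast
  have "s \<le> Re (cinner x v)"
  proof (rule field_le_epsilon)
    fix e :: real assume "e > 0"
    then obtain n where "1 / Suc n < e" using nat_approx_posE by blast
    with x[of n] show "s \<le> Re (cinner x v) + e" by (auto simp: D_def)
  qed
  then have "\<forall>y\<in>C. Re (cinner y v) \<le> Re (cinner x v)"
    using le_s by (meson order_trans)
  then have "x \<in> face v C"
    using x[of 0] by (simp add: face_def D_def)
  then show ?thesis by blast
qed

text \<open>Maximise the functionals given by a countable separating set \<open>V\<close> one after the other. A point
  \<open>x\<close> that survives all steps is extreme: if \<open>x + z\<close> and \<open>x - z\<close> are in \<open>C\<close>, then they remain
  in each successive face, so every functional from \<open>V\<close> vanishes on \<open>z\<close>.\<close>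

lemma exists_extreme_point:
  fixes C :: "'h::chilbert_space set" and V :: "'h set"
  assumes C: "closed C" "C \<noteq> {}" "bounded C"
    and mid: "\<And>x y. x \<in> C \<Longrightarrow> y \<in> C \<Longrightarrow> (1/2) *\<^sub>R (x + y) \<in> C"
    and V: "countable V" "V \<noteq> {}" "\<And>z. (\<And>v. v \<in> V \<Longrightarrow> Re (cinner z v) = 0) \<Longrightarrow> z = 0"
  shows "\<exists>x\<in>C. \<forall>z. x + z \<in> C \<and> x - z \<in> C \<longrightarrow> z = 0"
proof -
  define v where "v = from_nat_into V"
  define E where "E = rec_nat C (\<lambda>n. face (v n))"
  have E_0: "E 0 = C" and E_Suc: "E (Suc n) = face (v n) (E n)" for n
    unfolding E_def by simp_all
  have decr: "E n \<subseteq> E m" if "m \<le> n" for m n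
    by (rule lift_Suc_antimono_le[of E, OF _ that]) (simp only: E_Suc face_subset)
  have E: "closed (E n) \<and> E n \<noteq> {} \<and> bounded (E n) \<and>
      (\<forall>x\<in>E n. \<forall>y\<in>E n. (1/2) *\<^sub>R (x + y) \<in> E n)" for n
  proof (induction n)
    case 0
    show ?case unfolding E_0 by (intro conjI ballI C mid)
  next
    case (Suc n)
    then have IH: "closed (E n)" "E n \<noteq> {}" "bounded (E n)"
      "\<And>x y. x \<in> E n \<Longrightarrow> y \<in> E n \<Longrightarrow> (1/2) *\<^sub>R (x + y) \<in> E n"
      by blast+
    show ?case
      unfolding E_Suc
      by (intro conjI ballI closed_face face_nonempty face_midpoint bounded_subset[OF _ face_subset] IH)
  qed
  have "\<exists>x. \<forall>n. x \<in> E n"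
    using E by (intro nested_closed_midpoint_convex_nonempty decr) auto
  then obtain x where x: "x \<in> E n" for n by blast
  have "z = 0" if z: "x + z \<in> C" "x - z \<in> C" for z
  proof -
    have orth: "Re (cinner z (v n)) = 0" if "x + z \<in> E n" "x - z \<in> E n" for n
    proof -
      have "Re (cinner (x + z) (v n)) \<le> Re (cinner x (v n))"
        "Re (cinner (x - z) (v n)) \<le> Re (cinner x (v n))"
        using that x[of "Suc n"] by (simp_all add: E_Suc face_def)
      then show ?thesis by (simp add: cinner_simps)
    qed
    have "x + z \<in> E n \<and> x - z \<in> E n" for n
    proof (induction n)
      case 0
      then show ?case using z by (simp add: E_0)
    next
      case (Suc n)
      then show ?case
        using orth[of n] x[of "Suc n"] by (simp add: E_Suc face_def cinner_simps)
    qed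
    with orth have "Re (cinner z (v n)) = 0" for n by blast
    then have "Re (cinner z w) = 0" if "w \<in> V" for w
      using from_nat_into_surj[OF V(1) that] by (auto simp: v_def)
    then show "z = 0" by (rule V(3))
  qed
  moreover have "x \<in> C" using x[of 0] by (simp add: E_0)
  ultimately show ?thesis by blast
qed

section \<open>Sums of square-summable coefficients over Bessel families\<close>

lemma summable_on_Cauchy:
  fixes f :: "'i \<Rightarrow> 'a::banach"
  assumes "\<And>e. e > 0 \<Longrightarrow>
    \<exists>F0. finite F0 \<and> F0 \<subseteq> A \<and> (\<forall>F. finite F \<longrightarrow> F \<subseteq> A - F0 \<longrightarrow> norm (sum f F) < e)"
  shows "f summable_on A"
proof -
  have "\<exists>P. eventually P (finite_subsets_at_top A) \<and>
      (\<forall>F F'. P F \<and> P F' \<longrightarrow> dist (sum f F) (sum f F') < e)" if "e > 0" for e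
  proof -
    obtain F0 where F0: "finite F0" "F0 \<subseteq> A"
      "\<And>F. finite F \<Longrightarrow> F \<subseteq> A - F0 \<Longrightarrow> norm (sum f F) < e / 2"
      using assms[of "e / 2"] \<open>e > 0\<close> by auto
    define P where "P F \<longleftrightarrow> finite F \<and> F0 \<subseteq> F \<and> F \<subseteq> A" for F
    have "eventually P (finite_subsets_at_top A)"
      unfolding eventually_finite_subsets_at_top P_def using F0 by blast
    moreover have "dist (sum f F) (sum f F') < e" if "P F" "P F'" for F F'
    proof -
      have "sum f E = sum f F0 + sum f (E - F0)" "norm (sum f (E - F0)) < e / 2" if "P E" for E
        using that F0(3)[of "E - F0"] sum.subset_diff[of F0 E f] by (auto simp: P_def add.commute)
      from this[OF \<open>P F\<close>] this[OF \<open>P F'\<close>] show ?thesis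
        using norm_triangle_ineq4[of "sum f (F - F0)" "sum f (F' - F0)"] by (simp add: dist_norm)
    qed
    ultimately show ?thesis by blast
  qed
  then have "cauchy_filter (filtermap (sum f) (finite_subsets_at_top A))"
    by (simp add: cauchy_filter_metric_filtermap)
  moreover have "complete (UNIV::'a set)"
    by (meson Cauchy_convergent UNIV_I complete_def convergent_def)
  ultimately obtain L where "(sum f \<longlongrightarrow> L) (finite_subsets_at_top A)"
    using complete_uniform[where S=UNIV] by (force simp add: filterlim_def)
  then show ?thesis
    using summable_on_def has_sum_def by blast
qed

text \<open>Synthesis is adjoint to analysis, so the Bessel inequality bounds it with the same constant.
  Pairing the sum \<open>s\<close> with itself and using \<open>2 a b \<le> a\<^sup>2 + b\<^sup>2\<close> termwise bounds \<open>2 (norm s)\<^sup>2\<close>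
  by the right-hand side plus the Bessel sum of \<open>s\<close>, which is at most \<open>(norm s)\<^sup>2\<close>.\<close>

lemma norm_sum_scaleC_sq_le:
  fixes e :: "'i \<Rightarrow> 'h::complex_inner"
  assumes bessel: "\<And>f. (\<Sum>i\<in>F. (cmod (cinner f (e i)))\<^sup>2) \<le> (norm f)\<^sup>2"
  shows "(norm (\<Sum>i\<in>F. c i *\<^sub>C e i))\<^sup>2 \<le> (\<Sum>i\<in>F. (cmod (c i))\<^sup>2)"
proof -
  define s where "s = (\<Sum>i\<in>F. c i *\<^sub>C e i)"
  have "2 * (norm s)\<^sup>2 = (\<Sum>i\<in>F. 2 * Re (c i * cinner (e i) s))"
    unfolding norm_sq_eq_Re_cinner
    by (subst (1) s_def) (simp add: cinner_sum_left cinner_scaleC_left sum_distrib_left)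
  also have "\<dots> \<le> (\<Sum>i\<in>F. (cmod (c i))\<^sup>2 + (cmod (cinner s (e i)))\<^sup>2)"
  proof (rule sum_mono)
    fix i
    have "Re (c i * cinner (e i) s) \<le> cmod (c i) * cmod (cinner s (e i))"
      using complex_Re_le_cmod[of "c i * cinner (e i) s"]
      by (subst (asm) (2) cinner_commute) (simp add: norm_mult)
    then show "2 * Re (c i * cinner (e i) s) \<le> (cmod (c i))\<^sup>2 + (cmod (cinner s (e i)))\<^sup>2"
      using sum_squares_bound[of "cmod (c i)" "cmod (cinner s (e i))"] by linarith
  qed
  also have "\<dots> \<le> (\<Sum>i\<in>F. (cmod (c i))\<^sup>2) + (norm s)\<^sup>2"
    using bessel[of s] by (simp add: sum.distrib)
  finally show ?thesis by (simp add: s_def)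
qed

lemma summable_on_scaleC_bessel:
  fixes e :: "'i \<Rightarrow> 'h::chilbert_space"
  assumes bessel: "\<And>f F. finite F \<Longrightarrow> F \<subseteq> I \<Longrightarrow> (\<Sum>i\<in>F. (cmod (cinner f (e i)))\<^sup>2) \<le> (norm f)\<^sup>2"
    and c: "(\<lambda>i. (cmod (c i))\<^sup>2) summable_on I"
  shows "(\<lambda>i. c i *\<^sub>C e i) summable_on I"
proof (rule summable_on_Cauchy)
  fix r :: real assume "r > 0"
  let ?q = "\<lambda>i. (cmod (c i))\<^sup>2"
  obtain F0 where F0: "finite F0" "F0 \<subseteq> I" "dist (sum ?q F0) (infsum ?q I) \<le> r\<^sup>2 / 2"
    using infsum_finite_approximation[OF c, of "r\<^sup>2 / 2"] \<open>r > 0\<close> by auto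
  have "norm (\<Sum>i\<in>F. c i *\<^sub>C e i) < r" if F: "finite F" "F \<subseteq> I - F0" for F
  proof -
    have "sum ?q F0 + sum ?q F = sum ?q (F0 \<union> F)"
      using F F0 by (intro sum.union_disjoint[symmetric]) auto
    also have "\<dots> \<le> infsum ?q I"
      using F F0 by (intro finite_sum_le_infsum c) auto
    finally have "sum ?q F < r\<^sup>2"
      using F0(3) \<open>r > 0\<close> zero_less_power[of r 2] unfolding dist_real_def by linarith
    moreover have "(norm (\<Sum>i\<in>F. c i *\<^sub>C e i))\<^sup>2 \<le> sum ?q F"
      using F by (intro norm_sum_scaleC_sq_le bessel) auto
    ultimately show ?thesis
      using \<open>r > 0\<close> by (intro power2_less_imp_less[of _ r]) auto
  qed
  then show "\<exists>F0. finite F0 \<and> F0 \<subseteq> I \<and>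
      (\<forall>F. finite F \<longrightarrow> F \<subseteq> I - F0 \<longrightarrow> norm (\<Sum>i\<in>F. c i *\<^sub>C e i) < r)"
    using F0 by blast
qed

lemma has_sum_diff:
  fixes f g :: "'i \<Rightarrow> 'b::real_normed_vector"
  assumes "(f has_sum a) A" "(g has_sum b) A"
  shows "((\<lambda>i. f i - g i) has_sum (a - b)) A"
  using has_sum_add[OF assms(1) has_sum_bounded_linear[OF bounded_linear_minus[OF bounded_linear_ident] assms(2)]]
  by simp

lemma norm_sq_has_sum_le:
  assumes "(f has_sum s) A" "\<And>F. finite F \<Longrightarrow> F \<subseteq> A \<Longrightarrow> (norm (sum f F))\<^sup>2 \<le> B"
  shows "(norm s)\<^sup>2 \<le> B"
proof (rule tendsto_upperbound)
  show "((\<lambda>F. (norm (sum f F))\<^sup>2) \<longlongrightarrow> (norm s)\<^sup>2) (finite_subsets_at_top A)"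
    using assms(1) unfolding has_sum_def by (intro tendsto_intros)
  show "\<forall>\<^sub>F F in finite_subsets_at_top A. (norm (sum f F))\<^sup>2 \<le> B"
    using assms(2) by (intro eventually_finite_subsets_at_top_weakI) auto
qed simp

section \<open>Bessel vectors of a unitary representation\<close>

locale unitary_rep = group G for G (structure) +
  fixes \<pi> :: "'a \<Rightarrow> 'h::chilbert_space \<Rightarrow> 'h"
  assumes unitary_representation: "unitary_representation G \<pi>"
begin

lemma unitary_op_rep: "g \<in> carrier G \<Longrightarrow> unitary_op (\<pi> g)"
  using unitary_representation
  by (auto simp: unitary_representation_def unitary_group_def dest: hom_in_carrier)

lemma linear_rep: "g \<in> carrier G \<Longrightarrow> Vector_Spaces.linear scaleC scaleC (\<pi> g)"
  using unitary_op_rep by (simp add: unitary_op_def)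

lemma rep_add: "g \<in> carrier G \<Longrightarrow> \<pi> g (x + y) = \<pi> g x + \<pi> g y"
  and rep_diff: "g \<in> carrier G \<Longrightarrow> \<pi> g (x - y) = \<pi> g x - \<pi> g y"
  and rep_scaleC: "g \<in> carrier G \<Longrightarrow> \<pi> g (c *\<^sub>C x) = c *\<^sub>C \<pi> g x"
  and rep_zero: "g \<in> carrier G \<Longrightarrow> \<pi> g 0 = 0"
  using linear_rep[of g] by (auto simp: Vector_Spaces.linear_iff_module_hom
      module_hom.add module_hom.diff module_hom.scale module_hom.zero)

lemma rep_scaleR: "g \<in> carrier G \<Longrightarrow> \<pi> g (r *\<^sub>R x) = r *\<^sub>R \<pi> g x"
  by (simp add: scaleR_scaleC rep_scaleC)

lemma rep_mult: "g \<in> carrier G \<Longrightarrow> k \<in> carrier G \<Longrightarrow> \<pi> (g \<otimes> k) x = \<pi> g (\<pi> k x)"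
  using unitary_representation
  by (simp add: unitary_representation_def unitary_group_def hom_def)

lemma cinner_rep: "g \<in> carrier G \<Longrightarrow> cinner (\<pi> g x) (\<pi> g y) = cinner x y"
  using unitary_op_rep by (simp add: unitary_op_def)

lemma norm_rep: "g \<in> carrier G \<Longrightarrow> norm (\<pi> g x) = norm x"
  using cinner_rep[of g x x] by (simp add: cinner_self flip: of_real_power)

lemma rep_one: "\<pi> \<one> x = x"
proof (rule injD[OF inj_unitary_op[OF unitary_op_rep]])
  show "\<pi> \<one> (\<pi> \<one> x) = \<pi> \<one> x"
    by (simp flip: rep_mult)
qed simp

lemma rep_inv_rep [simp]:
  assumes "g \<in> carrier G"
  shows "\<pi> (inv g) (\<pi> g x) = x" "\<pi> g (\<pi> (inv g) x) = x"
  using assms by (simp_all add: rep_one flip: rep_mult)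

lemma cinner_rep_left: "g \<in> carrier G \<Longrightarrow> cinner (\<pi> g x) y = cinner x (\<pi> (inv g) y)"
  using cinner_rep[of "inv g" "\<pi> g x" y] by simp

lemma bounded_linear_rep: "g \<in> carrier G \<Longrightarrow> bounded_linear (\<pi> g)"
  by (rule bounded_linear_intro[where K = 1]) (simp_all add: rep_add rep_scaleR norm_rep)

text \<open>The vectors whose analysis operator \<open>f \<mapsto> (\<langle>f, \<pi> g u\<rangle>)\<^sub>g\<close> into \<open>l\<^sup>2(G)\<close> is a contraction. The
  bound is put on finite sums, so that closedness and convexity can be read off without limits.\<close>

definition bessel :: "'h \<Rightarrow> bool" where
  "bessel u \<longleftrightarrow> (\<forall>f F. finite F \<longrightarrow> F \<subseteq> carrier G \<longrightarrow>
     (\<Sum>g\<in>F. (cmod (cinner f (\<pi> g u)))\<^sup>2) \<le> (norm f)\<^sup>2)"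

lemma bessel_sum_le:
  "bessel u \<Longrightarrow> finite F \<Longrightarrow> F \<subseteq> carrier G \<Longrightarrow> (\<Sum>g\<in>F. (cmod (cinner f (\<pi> g u)))\<^sup>2) \<le> (norm f)\<^sup>2"
  by (simp add: bessel_def)

lemma bessel_summable: "bessel u \<Longrightarrow> (\<lambda>g. (cmod (cinner f (\<pi> g u)))\<^sup>2) summable_on carrier G"
  by (rule nonneg_bdd_above_summable_on) (auto intro!: bdd_aboveI2 bessel_sum_le)

lemma bessel_norm_le_1:
  assumes "bessel u"
  shows "norm u \<le> 1"
proof (cases "u = 0")
  case False
  have "(cmod (cinner u (\<pi> \<one> u)))\<^sup>2 \<le> (norm u)\<^sup>2"
    using bessel_sum_le[OF assms, of "{\<one>}" u] by simp
  then have "(norm u)\<^sup>2 * (norm u)\<^sup>2 \<le> 1 * (norm u)\<^sup>2"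
    by (simp add: rep_one cinner_self norm_power power2_eq_square[of "(norm u)\<^sup>2"] flip: of_real_power)
  then have "(norm u)\<^sup>2 \<le> 1"
    by (rule mult_right_le_imp_le) (use False in simp)
  then show ?thesis using power2_le_imp_le[of "norm u" 1] by simp
qed simp

lemma bessel_zero: "bessel 0"
  by (simp add: bessel_def rep_zero subset_iff)

lemma bessel_uminus: "bessel u \<Longrightarrow> bessel (- u)"
  using rep_diff[of _ 0 u] by (simp add: bessel_def rep_zero cinner_minus_right subset_iff)

lemma bessel_midpoint:
  assumes "bessel u" "bessel v"
  shows "bessel ((1/2) *\<^sub>R (u + v))"
  unfolding bessel_def
proof (intro allI impI)
  fix f F assume F: "finite F" "F \<subseteq> carrier G"
  have "(\<Sum>g\<in>F. (cmod (cinner f (\<pi> g ((1/2) *\<^sub>R (u + v)))))\<^sup>2)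
      \<le> (\<Sum>g\<in>F. (1/2) * (cmod (cinner f (\<pi> g u)))\<^sup>2 + (1/2) * (cmod (cinner f (\<pi> g v)))\<^sup>2)"
  proof (rule sum_mono)
    fix g assume "g \<in> F"
    let ?a = "cinner f (\<pi> g u)" and ?b = "cinner f (\<pi> g v)"
    have "cinner f (\<pi> g ((1/2) *\<^sub>R (u + v))) = (1/2) * (?a + ?b)"
      using \<open>g \<in> F\<close> F(2) by (simp add: rep_add rep_scaleR cinner_simps subset_iff)
    moreover have "(cmod ((1/2) * (?a + ?b)))\<^sup>2 + (cmod ((1/2) * (?a - ?b)))\<^sup>2
        = (1/2) * (cmod ?a)\<^sup>2 + (1/2) * (cmod ?b)\<^sup>2"
      using parallelogram[of ?a ?b] by (simp add: norm_divide power_divide)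
    ultimately show "(cmod (cinner f (\<pi> g ((1/2) *\<^sub>R (u + v)))))\<^sup>2
        \<le> (1/2) * (cmod ?a)\<^sup>2 + (1/2) * (cmod ?b)\<^sup>2"
      using zero_le_power2[of "cmod ((1/2) * (?a - ?b))"] by (simp only:)
  qed
  also have "\<dots> \<le> (norm f)\<^sup>2"
    using bessel_sum_le[OF assms(1) F, of f] bessel_sum_le[OF assms(2) F, of f]
    by (simp add: sum.distrib flip: sum_divide_distrib)
  finally show "(\<Sum>g\<in>F. (cmod (cinner f (\<pi> g ((1/2) *\<^sub>R (u + v)))))\<^sup>2) \<le> (norm f)\<^sup>2" .
qed

lemma bessel_half_diff: "bessel u \<Longrightarrow> bessel v \<Longrightarrow> bessel ((1/2) *\<^sub>R (u - v))"
  using bessel_midpoint[of u "- v"] by (simp add: bessel_uminus)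

lemma closed_bessel: "closed {u. bessel u}"
proof -
  have "closed {u. (\<Sum>g\<in>F. (cmod (cinner f (\<pi> g u)))\<^sup>2) \<le> (norm f)\<^sup>2}"
    if "F \<subseteq> carrier G" for f F
  proof (rule closed_Collect_le)
    show "continuous_on UNIV (\<lambda>u. \<Sum>g\<in>F. (cmod (cinner f (\<pi> g u)))\<^sup>2)"
    proof (intro continuous_on_sum continuous_on_power continuous_on_norm)
      show "continuous_on UNIV (\<lambda>u. cinner f (\<pi> g u))" if "g \<in> F" for g
        using that \<open>F \<subseteq> carrier G\<close>
        by (intro linear_continuous_on[OF bounded_linear_compose[OF bounded_linear_cinner_right bounded_linear_rep]])
          auto
    qed
  qed (rule continuous_on_const)
  then have "closed (\<Inter>f. \<Inter>F\<in>{F. finite F \<and> F \<subseteq> carrier G}.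
      {u. (\<Sum>g\<in>F. (cmod (cinner f (\<pi> g u)))\<^sup>2) \<le> (norm f)\<^sup>2})"
    by (intro closed_INT ballI) simp
  also have "(\<Inter>f. \<Inter>F\<in>{F. finite F \<and> F \<subseteq> carrier G}.
      {u. (\<Sum>g\<in>F. (cmod (cinner f (\<pi> g u)))\<^sup>2) \<le> (norm f)\<^sup>2}) = {u. bessel u}"
    by (auto simp: bessel_def)
  finally show ?thesis .
qed

text \<open>Passing from \<open>u\<close> to \<open>\<pi> k u\<close> translates the index of the coefficients from the right.\<close>

lemma bessel_rep:
  assumes "bessel u" "k \<in> carrier G"
  shows "bessel (\<pi> k u)"
  unfolding bessel_def
proof (intro allI impI)
  fix f F assume F: "finite F" "F \<subseteq> carrier G"
  have "(\<Sum>g\<in>F. (cmod (cinner f (\<pi> g (\<pi> k u))))\<^sup>2) = (\<Sum>g\<in>F. (cmod (cinner f (\<pi> (g \<otimes> k) u)))\<^sup>2)"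
    using F assms by (intro sum.cong) (auto simp: rep_mult)
  also have "\<dots> = (\<Sum>g\<in>(\<lambda>g. g \<otimes> k) ` F. (cmod (cinner f (\<pi> g u)))\<^sup>2)"
    using F assms by (subst sum.reindex) (auto intro!: inj_onI simp: subset_iff)
  also have "\<dots> \<le> (norm f)\<^sup>2"
    using F assms by (intro bessel_sum_le) auto
  finally show "(\<Sum>g\<in>F. (cmod (cinner f (\<pi> g (\<pi> k u))))\<^sup>2) \<le> (norm f)\<^sup>2" .
qed

text \<open>Analysis with \<open>u\<close> followed by synthesis with \<open>w\<close>. For \<open>u = w\<close> this is the frame operator of the
  orbit of \<open>u\<close>. These operators commute with \<open>\<pi>\<close> (\<open>rep_cross\<close>) and are the intertwiners that the
  proof needs.\<close>

definition cross :: "'h \<Rightarrow> 'h \<Rightarrow> 'h \<Rightarrow> 'h" where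
  "cross u w f = (\<Sum>\<^sub>\<infinity>g\<in>carrier G. cinner f (\<pi> g u) *\<^sub>C \<pi> g w)"

lemma has_sum_cross:
  assumes "bessel u" "bessel w"
  shows "((\<lambda>g. cinner f (\<pi> g u) *\<^sub>C \<pi> g w) has_sum cross u w f) (carrier G)"
  unfolding cross_def
  by (intro has_sum_infsum summable_on_scaleC_bessel bessel_sum_le bessel_summable assms)

lemma has_sum_cinner_cross:
  assumes "bessel u" "bessel w"
  shows "((\<lambda>g. cinner f (\<pi> g u) * cinner (\<pi> g w) k) has_sum cinner (cross u w f) k) (carrier G)"
  using has_sum_bounded_linear[OF bounded_linear_cinner_left has_sum_cross[OF assms]]
  by (simp add: cinner_scaleC_left)

lemma cross_adjoint:
  assumes "bessel u" "bessel w"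
  shows "cinner (cross u w f) k = cinner f (cross w u k)"
proof -
  have "((\<lambda>g. cnj (cinner k (\<pi> g w) * cinner (\<pi> g u) f)) has_sum cnj (cinner (cross w u k) f)) (carrier G)"
    unfolding has_sum_cnj_iff by (rule has_sum_cinner_cross[OF assms(2,1)])
  moreover have "cnj (cinner k (\<pi> g w) * cinner (\<pi> g u) f) = cinner f (\<pi> g u) * cinner (\<pi> g w) k" for g
    by (simp add: cinner_commute[of _ k] cinner_commute[of _ f])
  ultimately have "((\<lambda>g. cinner f (\<pi> g u) * cinner (\<pi> g w) k) has_sum cnj (cinner (cross w u k) f)) (carrier G)"
    by (simp only:)
  then have "cinner (cross u w f) k = cnj (cinner (cross w u k) f)"
    by (rule has_sum_unique[OF has_sum_cinner_cross[OF assms]])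
  then show ?thesis
    by (simp flip: cinner_commute)
qed

lemma has_sum_frame:
  assumes "bessel u"
  shows "((\<lambda>g. (cmod (cinner f (\<pi> g u)))\<^sup>2) has_sum Re (cinner (cross u u f) f)) (carrier G)"
proof -
  have "Re (cinner f (\<pi> g u) * cinner (\<pi> g u) f) = (cmod (cinner f (\<pi> g u)))\<^sup>2" for g
    by (subst (2) cinner_commute) (simp flip: complex_norm_square del: of_real_power)
  then show ?thesis
    using has_sum_Re[OF has_sum_cinner_cross[OF assms assms, of f f]] by (simp only:)
qed

lemma frame_bounds:
  assumes "bessel u"
  shows "0 \<le> Re (cinner (cross u u f) f)" "Re (cinner (cross u u f) f) \<le> (norm f)\<^sup>2"
  by (rule has_sum_nonneg[OF has_sum_frame[OF assms]], simp)
    (rule has_sum_le_finite_sums[OF has_sum_frame[OF assms] bessel_sum_le[OF assms]])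

lemma norm_cross_sq_le:
  assumes "bessel u" "bessel w"
  shows "(norm (cross u w f))\<^sup>2 \<le> Re (cinner (cross u u f) f)"
proof (rule norm_sq_has_sum_le[OF has_sum_cross[OF assms]])
  fix F assume F: "finite F" "F \<subseteq> carrier G"
  have "(norm (\<Sum>g\<in>F. cinner f (\<pi> g u) *\<^sub>C \<pi> g w))\<^sup>2 \<le> (\<Sum>g\<in>F. (cmod (cinner f (\<pi> g u)))\<^sup>2)"
    using F assms(2) by (intro norm_sum_scaleC_sq_le bessel_sum_le)
  also have "\<dots> \<le> Re (cinner (cross u u f) f)"
    using F by (intro finite_sum_le_has_sum[OF has_sum_frame[OF assms(1)]]) auto
  finally show "(norm (\<Sum>g\<in>F. cinner f (\<pi> g u) *\<^sub>C \<pi> g w))\<^sup>2 \<le> Re (cinner (cross u u f) f)" .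
qed

lemma bounded_linear_cross:
  assumes "bessel u" "bessel w"
  shows "bounded_linear (cross u w)"
proof (rule bounded_linear_intro[where K = 1])
  show "cross u w (x + y) = cross u w x + cross u w y" for x y
    by (rule cinner_eqI) (simp add: cross_adjoint assms cinner_simps)
  show "cross u w (r *\<^sub>R x) = r *\<^sub>R cross u w x" for r x
    by (rule cinner_eqI) (simp add: cross_adjoint assms cinner_simps)
  show "norm (cross u w x) \<le> norm x * 1" for x
    using power2_le_imp_le[OF order_trans[OF norm_cross_sq_le[OF assms] frame_bounds(2)[OF assms(1)]]]
    by simp
qed

lemma cross_scaleC:
  "bessel u \<Longrightarrow> bessel w \<Longrightarrow> cross u w (c *\<^sub>C x) = c *\<^sub>C cross u w x"
  by (rule cinner_eqI) (simp add: cross_adjoint cinner_simps)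

lemma rep_cross:
  assumes "bessel u" "bessel w" "k \<in> carrier G"
  shows "\<pi> k (cross u w f) = cross u w (\<pi> k f)"
proof (rule has_sum_unique)
  have "((\<lambda>g. cinner (\<pi> k f) (\<pi> (k \<otimes> g) u) *\<^sub>C \<pi> (k \<otimes> g) w) has_sum \<pi> k (cross u w f)) (carrier G)
      \<longleftrightarrow> ((\<lambda>g. \<pi> k (cinner f (\<pi> g u) *\<^sub>C \<pi> g w)) has_sum \<pi> k (cross u w f)) (carrier G)"
    using assms(3) by (intro has_sum_cong) (simp add: rep_mult rep_scaleC cinner_rep)
  also have "\<dots>"
    by (intro has_sum_bounded_linear[OF bounded_linear_rep] has_sum_cross assms)
  also have "((\<lambda>g. cinner (\<pi> k f) (\<pi> (k \<otimes> g) u) *\<^sub>C \<pi> (k \<otimes> g) w) has_sum \<pi> k (cross u w f)) (carrier G)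
      \<longleftrightarrow> ((\<lambda>g. cinner (\<pi> k f) (\<pi> g u) *\<^sub>C \<pi> g w) has_sum \<pi> k (cross u w f)) (carrier G)"
    by (rule has_sum_reindex_bij_betw)
      (use assms(3) in \<open>auto intro!: bij_betwI[where g = "\<lambda>g. inv k \<otimes> g"] simp flip: m_assoc\<close>)
  finally show "((\<lambda>g. cinner (\<pi> k f) (\<pi> g u) *\<^sub>C \<pi> g w) has_sum \<pi> k (cross u w f)) (carrier G)" .
  show "((\<lambda>g. cinner (\<pi> k f) (\<pi> g u) *\<^sub>C \<pi> g w) has_sum cross u w (\<pi> k f)) (carrier G)"
    by (intro has_sum_cross assms)
qed

text \<open>An intertwiner moves over to the other argument as its adjoint, which is a contraction.\<close>

lemma bessel_cross:
  assumes "bessel u" "bessel w" "bessel v"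
  shows "bessel (cross u w v)"
  unfolding bessel_def
proof (intro allI impI)
  fix f F assume F: "finite F" "F \<subseteq> carrier G"
  have "(\<Sum>g\<in>F. (cmod (cinner f (\<pi> g (cross u w v))))\<^sup>2) = (\<Sum>g\<in>F. (cmod (cinner (cross w u f) (\<pi> g v)))\<^sup>2)"
    using F assms by (intro sum.cong) (auto simp: rep_cross cross_adjoint)
  also have "\<dots> \<le> (norm (cross w u f))\<^sup>2"
    using F assms by (intro bessel_sum_le)
  also have "\<dots> \<le> (norm f)\<^sup>2"
    by (rule order_trans[OF norm_cross_sq_le frame_bounds(2)]) (rule assms)+
  finally show "(\<Sum>g\<in>F. (cmod (cinner f (\<pi> g (cross u w v))))\<^sup>2) \<le> (norm f)\<^sup>2" .
qed

end

section \<open>Averaging over conjugates in an ICC group\<close>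

lemma (in group) bij_betw_conjugation:
  assumes k: "k \<in> carrier G"
  shows "bij_betw (\<lambda>g. k \<otimes> g \<otimes> inv k) (carrier G) (carrier G)"
proof (rule bij_betwI[where g = "\<lambda>g. inv k \<otimes> g \<otimes> k"])
  fix g assume g: "g \<in> carrier G"
  then show "inv k \<otimes> (k \<otimes> g \<otimes> inv k) \<otimes> k = g"
    using k by (simp add: m_assoc) (simp flip: m_assoc)
  show "k \<otimes> (inv k \<otimes> g \<otimes> k) \<otimes> inv k = g"
    using k g by (simp add: m_assoc) (simp flip: m_assoc)
qed (use k in auto)

lemma (in group) bij_betw_conjugation_nontrivial:
  assumes k: "k \<in> carrier G"
  shows "bij_betw (\<lambda>g. k \<otimes> g \<otimes> inv k) (carrier G - {\<one>}) (carrier G - {\<one>})"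
proof -
  have "bij_betw (\<lambda>g. k \<otimes> g \<otimes> inv k) {\<one>} {\<one>}"
    using k by (simp add: bij_betw_def)
  then show ?thesis
    using bij_betw_conjugation[OF k] by (intro bij_betw_DiffI) auto
qed

text \<open>Think of \<open>X\<close> as a convex set in \<open>l\<^sup>2(G)\<close> that is invariant under conjugation. A sequence in
  \<open>X\<close> that minimises the \<open>l\<^sup>2\<close>-norm away from \<open>\<one>\<close> is Cauchy by the parallelogram law, and for the
  same reason it is asymptotically invariant under conjugation, since conjugation preserves that
  norm. Its limit is constant on conjugacy classes and square-summable, hence \<open>0\<close> on the infinite
  ones.\<close>

lemma (in group) icc_average:
  fixes X :: "('a \<Rightarrow> complex) set"
  assumes icc: "\<And>g. g \<in> carrier G \<Longrightarrow> g \<noteq> \<one> \<Longrightarrow> infinite (conjugacy_class G g)"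
    and nonempty: "X \<noteq> {}"
    and l2: "\<And>c F. c \<in> X \<Longrightarrow> finite F \<Longrightarrow> F \<subseteq> carrier G \<Longrightarrow> (\<Sum>g\<in>F. (cmod (c g))\<^sup>2) \<le> B"
    and mid: "\<And>c c'. c \<in> X \<Longrightarrow> c' \<in> X \<Longrightarrow> (\<lambda>g. (c g + c' g) / 2) \<in> X"
    and conj: "\<And>c k. c \<in> X \<Longrightarrow> k \<in> carrier G \<Longrightarrow> (\<lambda>g. c (k \<otimes> g \<otimes> inv k)) \<in> X"
    and "e > 0"
  shows "\<exists>c\<in>X. \<forall>F. finite F \<longrightarrow> F \<subseteq> carrier G - {\<one>} \<longrightarrow> (\<Sum>g\<in>F. (cmod (c g))\<^sup>2) \<le> e"
proof -
  define S where "S = carrier G - {\<one>}"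
  define q where "q c = (\<Sum>\<^sub>\<infinity>g\<in>S. (cmod (c g))\<^sup>2)" for c :: "'a \<Rightarrow> complex"
  define d where "d = Inf (q ` X)"
  have summ: "(\<lambda>g. (cmod (c g))\<^sup>2) summable_on S" if "c \<in> X" for c
    by (rule nonneg_bdd_above_summable_on) (use l2[OF that] in \<open>auto intro!: bdd_aboveI2 simp: S_def\<close>)
  have bdd: "bdd_below (q ` X)"
    unfolding q_def by (rule bdd_belowI[where m = 0]) (auto intro!: infsum_nonneg)
  have d_le: "d \<le> q c" if "c \<in> X" for c
    unfolding d_def using that by (intro cInf_lower bdd) auto
  have close: "(\<Sum>g\<in>F. (cmod (c g - c' g))\<^sup>2) \<le> 4 * \<delta>"
    if c: "c \<in> X" "c' \<in> X" "q c \<le> d + \<delta>" "q c' \<le> d + \<delta>" and F: "finite F" "F \<subseteq> S" for c c' \<delta> F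
  proof -
    have par: "(cmod (c g - c' g))\<^sup>2
        = 2 * (cmod (c g))\<^sup>2 + 2 * (cmod (c' g))\<^sup>2 - 4 * (cmod ((c g + c' g) / 2))\<^sup>2" for g
      using parallelogram[of "c g" "c' g"] by (simp add: norm_divide power_divide)
    have "((\<lambda>g. (cmod (c g - c' g))\<^sup>2) has_sum
        2 * q c + 2 * q c' - 4 * q (\<lambda>g. (c g + c' g) / 2)) S"
      unfolding par q_def
      by (intro has_sum_add has_sum_diff has_sum_cmult_right has_sum_infsum summ c mid)
    then have "(\<Sum>g\<in>F. (cmod (c g - c' g))\<^sup>2) \<le> 2 * q c + 2 * q c' - 4 * q (\<lambda>g. (c g + c' g) / 2)"
      using F by (rule finite_sum_le_has_sum) simp
    then show ?thesis
      using d_le[OF mid[OF c(1,2)]] c(3,4) by simp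
  qed
  \<comment> \<open>A value above \<open>2 * \<delta>\<close> would force values of at least \<open>\<delta>\<close> on the whole infinite conjugacy class.\<close>
  have small: "cmod (c g) \<le> 2 * \<delta>" if c: "c \<in> X" "q c \<le> d + \<delta>\<^sup>2 / 4" and "\<delta> > 0" and g: "g \<in> S" for c \<delta> g
  proof (rule ccontr)
    assume big: "\<not> cmod (c g) \<le> 2 * \<delta>"
    have large: "\<delta> \<le> cmod (c x)" if x: "x \<in> conjugacy_class G g" for x
    proof -
      obtain k where k: "k \<in> carrier G" "x = k \<otimes> g \<otimes> inv k"
        using x by (auto simp: conjugacy_class_def)
      have "q (\<lambda>g. c (k \<otimes> g \<otimes> inv k)) = q c"
        unfolding q_def S_def
        by (rule infsum_reindex_bij_betw[OF bij_betw_conjugation_nontrivial[OF k(1)]])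
      then have "(\<Sum>g\<in>{g}. (cmod (c g - c (k \<otimes> g \<otimes> inv k)))\<^sup>2) \<le> 4 * (\<delta>\<^sup>2 / 4)"
        using c g k(1) by (intro close conj) auto
      then have "cmod (c g - c x) \<le> \<delta>"
        using \<open>\<delta> > 0\<close> k(2) by (auto intro: power2_le_imp_le)
      then show ?thesis
        using big norm_triangle_ineq2[of "c g" "c x"] by linarith
    qed
    have "finite (conjugacy_class G g)"
    proof (rule conjunct1[OF finite_if_finite_subsets_card_bdd[of _ "nat \<lceil>B / \<delta>\<^sup>2\<rceil>"]])
      fix F assume F: "F \<subseteq> conjugacy_class G g" "finite F"
      then have "F \<subseteq> carrier G"
        using g by (auto simp: conjugacy_class_def S_def)
      have "real (card F) * \<delta>\<^sup>2 = (\<Sum>x\<in>F. \<delta>\<^sup>2)" by simp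
      also have "\<dots> \<le> (\<Sum>x\<in>F. (cmod (c x))\<^sup>2)"
        using F large \<open>\<delta> > 0\<close> by (intro sum_mono power_mono) auto
      also have "\<dots> \<le> B" by (rule l2) fact+
      finally have "real (card F) \<le> B / \<delta>\<^sup>2"
        using \<open>\<delta> > 0\<close> by (simp add: field_simps)
      then show "card F \<le> nat \<lceil>B / \<delta>\<^sup>2\<rceil>" by linarith
    qed
    then show False using icc g by (auto simp: S_def)
  qed
  have "\<exists>c. c \<in> X \<and> q c < d + r" if "r > 0" for r
  proof -
    have "\<exists>s\<in>q ` X. s < d + r"
      using nonempty that unfolding d_def by (intro cInf_lessD) auto
    then show ?thesis by auto
  qed
  then have "\<forall>n. \<exists>c. c \<in> X \<and> q c < d + (inverse (real (Suc n)))\<^sup>2 / 4" by simp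
  then obtain c where cX: "\<And>n. c n \<in> X" and "\<And>n. q (c n) < d + (inverse (real (Suc n)))\<^sup>2 / 4"
    by metis
  then have qc: "q (c n) \<le> d + (inverse (real (Suc n)))\<^sup>2 / 4" for n
    by (simp add: less_imp_le)
  have to_0: "(\<lambda>n. c n g) \<longlonglongrightarrow> 0" if "g \<in> S" for g
  proof (rule Lim_null_comparison)
    show "\<forall>\<^sub>F n in sequentially. cmod (c n g) \<le> 2 * inverse (real (Suc n))"
      using small[OF cX qc _ that] by (intro always_eventually allI) simp
    show "(\<lambda>n. 2 * inverse (real (Suc n))) \<longlonglongrightarrow> 0"
      using tendsto_mult_right_zero[OF LIMSEQ_inverse_real_of_nat] by blast
  qed
  obtain n where n: "inverse (real (Suc n)) < sqrt e"
    using reals_Archimedean[of "sqrt e"] \<open>e > 0\<close> by auto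
  have "(\<Sum>g\<in>F. (cmod (c n g))\<^sup>2) \<le> e" if F: "finite F" "F \<subseteq> S" for F
  proof -
    have "(\<lambda>m. \<Sum>g\<in>F. (cmod (c n g - c m g))\<^sup>2) \<longlonglongrightarrow> (\<Sum>g\<in>F. (cmod (c n g - 0))\<^sup>2)"
      using F by (intro tendsto_intros to_0) auto
    moreover have "(\<Sum>g\<in>F. (cmod (c n g - c m g))\<^sup>2) \<le> (inverse (real (Suc n)))\<^sup>2" if "m \<ge> n" for m
    proof -
      have "(inverse (real (Suc m)))\<^sup>2 \<le> (inverse (real (Suc n)))\<^sup>2"
        using that by (intro power_mono le_imp_inverse_le) auto
      then have "q (c m) \<le> d + (inverse (real (Suc n)))\<^sup>2 / 4"
        using qc[of m] by linarith
      then show ?thesis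
        using close[OF cX[of n] cX[of m] qc[of n] _ F] by simp
    qed
    ultimately have "(\<Sum>g\<in>F. (cmod (c n g - 0))\<^sup>2) \<le> (inverse (real (Suc n)))\<^sup>2"
      by (intro LIMSEQ_le_const2) auto
    also have "\<dots> \<le> (sqrt e)\<^sup>2"
      using n by (intro power_mono) auto
    finally show ?thesis using \<open>e > 0\<close> by simp
  qed
  then show ?thesis using cX[of n] unfolding S_def by blast
qed

section \<open>Extreme Bessel vectors\<close>

context unitary_rep
begin

lemma besselI_has_sum:
  assumes "\<And>f. ((\<lambda>g. (cmod (cinner f (\<pi> g u)))\<^sup>2) has_sum s f) (carrier G)"
    and "\<And>f. s f \<le> (norm f)\<^sup>2"
  shows "bessel u"
  unfolding bessel_def
proof (intro allI impI)
  fix f F assume "finite F" "F \<subseteq> carrier G"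
  then have "(\<Sum>g\<in>F. (cmod (cinner f (\<pi> g u)))\<^sup>2) \<le> s f"
    by (intro finite_sum_le_has_sum[OF assms(1)]) auto
  then show "(\<Sum>g\<in>F. (cmod (cinner f (\<pi> g u)))\<^sup>2) \<le> (norm f)\<^sup>2"
    using assms(2) order_trans by blast
qed

definition extreme_bessel :: "'h \<Rightarrow> bool" where
  "extreme_bessel \<eta> \<longleftrightarrow> bessel \<eta> \<and> (\<forall>\<zeta>. bessel (\<eta> + \<zeta>) \<and> bessel (\<eta> - \<zeta>) \<longrightarrow> \<zeta> = 0)"

lemma extreme_besselD:
  assumes "extreme_bessel \<eta>"
  shows "bessel \<eta>" "bessel (\<eta> + \<zeta>) \<Longrightarrow> bessel (\<eta> - \<zeta>) \<Longrightarrow> \<zeta> = 0"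
  using assms by (auto simp: extreme_bessel_def)

text \<open>With \<open>A = cross \<eta> \<eta>\<close>, the new vector is the image of \<open>\<eta>\<close> under \<open>1 + s (1 - A)\<close>, so its frame
  operator is \<open>A (1 + s (1 - A))\<^sup>2\<close>, and \<open>t (1 + s (1 - t))\<^sup>2 \<le> 1\<close> for \<open>0 \<le> t \<le> 1\<close> and
  \<open>\<bar>s\<bar> \<le> 1/2\<close>. For \<open>s = 1/2\<close> this is one step of the Newton iteration that converges to the
  partial isometry of a polar decomposition.\<close>

lemma bessel_newton_step:
  fixes s :: real
  assumes "bessel \<eta>" "\<bar>s\<bar> \<le> 1/2"
  shows "bessel (\<eta> + s *\<^sub>R (\<eta> - cross \<eta> \<eta> \<eta>))"
proof -
  let ?A = "cross \<eta> \<eta>"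
  interpret A: bounded_linear ?A
    by (rule bounded_linear_cross[OF assms(1,1)])
  have shift: "cinner f (\<pi> g (\<eta> + s *\<^sub>R (\<eta> - ?A \<eta>))) = cinner (f + s *\<^sub>R (f - ?A f)) (\<pi> g \<eta>)"
    if "g \<in> carrier G" for f g
    using that assms(1) by (simp add: rep_add rep_scaleR rep_diff rep_cross cinner_simps cross_adjoint)
  have le: "Re (cinner (?A (f + s *\<^sub>R (f - ?A f))) (f + s *\<^sub>R (f - ?A f))) \<le> (norm f)\<^sup>2" for f
  proof -
    define b where "b = f - ?A f"
    \<comment> \<open>In these four numbers the operator inequality becomes linear, given \<open>s\<^sup>2 \<le> 1/4\<close> and \<open>2 * s \<le> 1\<close>.\<close>
    define a0 a1 a2 m where "a0 = Re (cinner (?A f) f)" "a1 = Re (cinner (?A f) b)"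
      "a2 = Re (cinner (?A b) b)" "m = (norm (?A f))\<^sup>2"
    have "Re (cinner (?A b) f) = a1"
      using assms(1) Re_cinner_commute[of b "?A f"] by (simp add: cross_adjoint a0_a1_a2_m_def)
    then have lhs: "Re (cinner (?A (f + s *\<^sub>R b)) (f + s *\<^sub>R b)) = a0 + 2 * s * a1 + s\<^sup>2 * a2"
      by (simp add: A.add A.scaleR cinner_simps a0_a1_a2_m_def power2_eq_square algebra_simps)
    have a1: "a1 = a0 - m"
      by (simp add: a0_a1_a2_m_def b_def cinner_simps norm_sq_eq_Re_cinner)
    have nb: "(norm b)\<^sup>2 = (norm f)\<^sup>2 - 2 * a0 + m"
      unfolding b_def norm_diff_sq a0_a1_a2_m_def using Re_cinner_commute[of f "?A f"] by simp
    have m: "m \<le> a0" "a0 \<le> (norm f)\<^sup>2"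
      unfolding a0_a1_a2_m_def
      by (rule norm_cross_sq_le[OF assms(1,1)], rule frame_bounds[OF assms(1)])
    have a2: "0 \<le> a2" "a2 \<le> (norm b)\<^sup>2"
      unfolding a0_a1_a2_m_def by (rule frame_bounds[OF assms(1)])+
    have "s\<^sup>2 \<le> 1/4"
      using assms(2) abs_le_square_iff[of s "1/2"] by (simp add: power2_eq_square)
    then have "s\<^sup>2 * a2 \<le> 1/4 * (norm b)\<^sup>2"
      using a2 by (intro mult_mono) auto
    moreover have "2 * s * a1 \<le> 1 * a1"
      using assms(2) m(1) a1 by (intro mult_right_mono) auto
    moreover have "0 \<le> (norm b)\<^sup>2" by simp
    ultimately show ?thesis
      unfolding b_def[symmetric] lhs using nb m a1 by linarith
  qed
  show ?thesis
  proof (rule besselI_has_sum)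
    fix f
    show "((\<lambda>g. (cmod (cinner f (\<pi> g (\<eta> + s *\<^sub>R (\<eta> - ?A \<eta>)))))\<^sup>2) has_sum
        Re (cinner (?A (f + s *\<^sub>R (f - ?A f))) (f + s *\<^sub>R (f - ?A f)))) (carrier G)"
      using has_sum_frame[OF assms(1), of "f + s *\<^sub>R (f - ?A f)"]
      by (subst has_sum_cong[where g = "\<lambda>g. (cmod (cinner (f + s *\<^sub>R (f - ?A f)) (\<pi> g \<eta>)))\<^sup>2"])
        (simp_all only: shift)
  qed (rule le)
qed

lemma extreme_bessel_fixed:
  assumes "extreme_bessel \<eta>"
  shows "cross \<eta> \<eta> \<eta> = \<eta>"
proof -
  note bessel = extreme_besselD(1)[OF assms]
  have "(1/2) *\<^sub>R (\<eta> - cross \<eta> \<eta> \<eta>) = 0"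
    using bessel_newton_step[OF bessel, of "1/2"] bessel_newton_step[OF bessel, of "-1/2"]
    by (intro extreme_besselD(2)[OF assms]) simp_all
  then show ?thesis by simp
qed

text \<open>Under the hypothesis \<open>cross \<eta> \<eta>\<close> fixes the orbit of \<open>\<eta>\<close>; being self-adjoint, it then does not
  change the coefficients \<open>\<langle>f, \<pi> g \<eta>\<rangle>\<close> of a vector. For \<open>w = \<eta>\<close> this says that it is a projection.\<close>

lemma cross_idem:
  assumes "bessel \<eta>" "bessel w" "cross \<eta> \<eta> \<eta> = \<eta>"
  shows "cross \<eta> w (cross \<eta> \<eta> f) = cross \<eta> w f"
proof (rule cinner_eqI)
  fix k
  have A_rep: "cross \<eta> \<eta> (\<pi> g \<eta>) = \<pi> g \<eta>" if "g \<in> carrier G" for g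
    using rep_cross[OF assms(1,1) that, of \<eta>] assms(3) by simp
  have "cinner (cross \<eta> \<eta> f) (\<pi> g \<eta>) = cinner f (\<pi> g \<eta>)" if "g \<in> carrier G" for g
    using A_rep[OF that] assms(1) by (simp add: cross_adjoint)
  then show "cinner (cross \<eta> w (cross \<eta> \<eta> f)) k = cinner (cross \<eta> w f) k"
    unfolding cross_def[of \<eta> w] by (simp cong: infsum_cong)
qed

text \<open>Put \<open>A = cross \<eta> \<eta>\<close> and \<open>\<zeta> = (y - cross \<eta> y \<eta>) / 2\<close>. Then \<open>\<zeta>\<close> is orthogonal to the orbit of \<open>\<eta>\<close>, so that the
  coefficients of \<open>f\<close> with respect to \<open>\<zeta>\<close> only see \<open>f - A f\<close>, and the coefficient sequences
  with respect to \<open>\<eta>\<close> and \<open>\<zeta>\<close> are orthogonal in \<open>l\<^sup>2\<close> (\<open>cross \<eta> \<zeta> = 0\<close>). By Pythagoras both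
  \<open>\<eta> + \<zeta>\<close> and \<open>\<eta> - \<zeta>\<close> are Bessel vectors, so \<open>\<zeta> = 0\<close> by extremality.\<close>

lemma extreme_bessel_rigid:
  assumes ext: "extreme_bessel \<eta>" and y: "bessel y" "cross \<eta> \<eta> y = 0"
  shows "cross \<eta> y \<eta> = y"
proof -
  let ?A = "cross \<eta> \<eta>" and ?S = "cross \<eta> y"
  note bessel = extreme_besselD(1)[OF ext]
  note fixed = extreme_bessel_fixed[OF ext]
  interpret A: bounded_linear ?A by (rule bounded_linear_cross[OF bessel bessel])
  interpret S: bounded_linear ?S by (rule bounded_linear_cross[OF bessel y(1)])
  have A_rep_y: "?A (\<pi> g y) = 0" if "g \<in> carrier G" for g
    using rep_cross[OF bessel bessel that, of y] y(2) that by (simp add: rep_zero)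
  have AS: "?A (?S f) = 0" for f
  proof (rule has_sum_unique)
    show "((\<lambda>g. ?A (cinner f (\<pi> g \<eta>) *\<^sub>C \<pi> g y)) has_sum ?A (?S f)) (carrier G)"
      by (intro has_sum_bounded_linear[OF A.bounded_linear_axioms] has_sum_cross bessel y)
    show "((\<lambda>g. ?A (cinner f (\<pi> g \<eta>) *\<^sub>C \<pi> g y)) has_sum 0) (carrier G)"
      by (rule has_sum_0) (simp add: cross_scaleC bessel A_rep_y)
  qed
  define \<zeta> where "\<zeta> = (1/2) *\<^sub>R (y - ?S \<eta>)"
  have \<zeta>: "bessel \<zeta>"
    unfolding \<zeta>_def by (intro bessel_half_diff bessel_cross bessel y)
  have A\<zeta>: "?A \<zeta> = 0"
    by (simp add: \<zeta>_def A.scaleR A.diff y AS)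
  have cross_\<zeta>: "cross \<eta> \<zeta> f = 0" for f
  proof (rule has_sum_unique)
    show "((\<lambda>g. cinner f (\<pi> g \<eta>) *\<^sub>C \<pi> g \<zeta>) has_sum cross \<eta> \<zeta> f) (carrier G)"
      by (intro has_sum_cross bessel \<zeta>)
    have "((\<lambda>g. cinner f (\<pi> g \<eta>) *\<^sub>C \<pi> g y - ?S (cinner f (\<pi> g \<eta>) *\<^sub>C \<pi> g \<eta>))
        has_sum 0) (carrier G)"
      unfolding diff_self[of "?S f", symmetric]
      by (subst (2) cross_idem[OF bessel y(1) fixed, of f, symmetric]) (intro has_sum_diff has_sum_bounded_linear[OF S.bounded_linear_axioms] has_sum_cross bessel y)
    then have "((\<lambda>g. (1/2) *\<^sub>R (cinner f (\<pi> g \<eta>) *\<^sub>C \<pi> g y - ?S (cinner f (\<pi> g \<eta>) *\<^sub>C \<pi> g \<eta>)))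
        has_sum 0) (carrier G)"
      using has_sum_bounded_linear[OF bounded_linear_scaleR_right[of "1/2"]] by fastforce
    moreover have "(1/2) *\<^sub>R (cinner f (\<pi> g \<eta>) *\<^sub>C \<pi> g y - ?S (cinner f (\<pi> g \<eta>) *\<^sub>C \<pi> g \<eta>))
        = cinner f (\<pi> g \<eta>) *\<^sub>C \<pi> g \<zeta>" if "g \<in> carrier G" for g
      using that bessel y(1)
      by (simp add: \<zeta>_def cross_scaleC rep_scaleR rep_scaleC rep_diff rep_cross scaleR_scaleC
          complex_vector.scale_right_diff_distrib scaleC_scaleC mult.commute)
    ultimately show "((\<lambda>g. cinner f (\<pi> g \<eta>) *\<^sub>C \<pi> g \<zeta>) has_sum 0) (carrier G)"
      by (simp cong: has_sum_cong)
  qed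
  have bessel_pm: "bessel (\<eta> + s *\<^sub>R \<zeta>)" if "s = 1 \<or> s = -1" for s :: real
  proof (rule besselI_has_sum)
    fix f
    define b where "b = f - ?A f"
    have p: "cinner f (\<pi> g \<zeta>) = cinner b (\<pi> g \<zeta>)" if "g \<in> carrier G" for g
      using rep_cross[OF bessel bessel that, of \<zeta>] A\<zeta> that bessel
      by (simp add: b_def cinner_simps cross_adjoint rep_zero)
    have sum_r: "((\<lambda>g. (cmod (cinner f (\<pi> g \<eta>)))\<^sup>2 + (cmod (cinner b (\<pi> g \<zeta>)))\<^sup>2
          + 2 * s * Re (cinner f (\<pi> g \<eta>) * cinner (\<pi> g \<zeta>) f)) has_sum
        Re (cinner (?A f) f) + Re (cinner (cross \<zeta> \<zeta> b) b) + 2 * s * Re (cinner (cross \<eta> \<zeta> f) f)) (carrier G)"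
      (is "(_ has_sum ?r) _")
      by (intro has_sum_add has_sum_cmult_right has_sum_frame has_sum_Re has_sum_cinner_cross bessel \<zeta>)
    have "?r = Re (cinner (?A f) f) + Re (cinner (cross \<zeta> \<zeta> b) b)"
      by (simp add: cross_\<zeta>)
    note sum_r[unfolded this]
    moreover have "(cmod (cinner f (\<pi> g \<eta>)))\<^sup>2 + (cmod (cinner b (\<pi> g \<zeta>)))\<^sup>2
          + 2 * s * Re (cinner f (\<pi> g \<eta>) * cinner (\<pi> g \<zeta>) f)
        = (cmod (cinner f (\<pi> g (\<eta> + s *\<^sub>R \<zeta>))))\<^sup>2" if g: "g \<in> carrier G" for g
    proof -
      let ?p = "cinner f (\<pi> g \<eta>)" and ?z = "cinner f (\<pi> g \<zeta>)"
      have "cinner (\<pi> g \<zeta>) f = cnj ?z" by (rule cinner_commute)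
      then show ?thesis
        using \<open>s = 1 \<or> s = -1\<close> norm_add_sq[of ?p ?z] norm_diff_sq[of ?p ?z]
          rep_diff[OF g, of 0 \<zeta>]
        unfolding p[OF g, symmetric]
        by (auto simp add: g rep_add rep_zero cinner_simps cinner_complex_def simp del: times_complex.sel)
    qed
    ultimately show "((\<lambda>g. (cmod (cinner f (\<pi> g (\<eta> + s *\<^sub>R \<zeta>))))\<^sup>2) has_sum
        Re (cinner (?A f) f) + Re (cinner (cross \<zeta> \<zeta> b) b)) (carrier G)"
      by (simp only: cong: has_sum_cong)
    have "Re (cinner (cross \<zeta> \<zeta> b) b) \<le> (norm b)\<^sup>2"
      by (rule frame_bounds[OF \<zeta>])
    also have "\<dots> = (norm f)\<^sup>2 - 2 * Re (cinner (?A f) f) + (norm (?A f))\<^sup>2"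
      unfolding b_def norm_diff_sq using Re_cinner_commute[of f "?A f"] by simp
    finally show "Re (cinner (?A f) f) + Re (cinner (cross \<zeta> \<zeta> b) b) \<le> (norm f)\<^sup>2"
      using norm_cross_sq_le[OF bessel bessel, of f] by linarith
  qed
  have "\<zeta> = 0"
    using bessel_pm[of 1] bessel_pm[of "-1"] by (intro extreme_besselD(2)[OF ext]) simp_all
  then show ?thesis by (simp add: \<zeta>_def)
qed

text \<open>The rigidity of \<open>\<pi> k y\<close>, transported back to \<open>y\<close> by \<open>\<pi> (inv k)\<close>.\<close>

lemma extreme_bessel_conjugated_expansion:
  assumes ext: "extreme_bessel \<eta>" and y: "bessel y" "cross \<eta> \<eta> y = 0" and k: "k \<in> carrier G"
  shows "((\<lambda>g. cinner \<eta> (\<pi> (k \<otimes> g \<otimes> inv k) \<eta>) *\<^sub>C \<pi> g y) has_sum y) (carrier G)"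
proof -
  note bessel = extreme_besselD(1)[OF ext]
  have "cross \<eta> \<eta> (\<pi> k y) = 0"
    using rep_cross[OF bessel bessel k, of y] y(2) k by (simp add: rep_zero)
  then have "cross \<eta> (\<pi> k y) \<eta> = \<pi> k y"
    by (intro extreme_bessel_rigid ext bessel_rep y k)
  then have "((\<lambda>g. cinner \<eta> (\<pi> g \<eta>) *\<^sub>C \<pi> g (\<pi> k y)) has_sum \<pi> k y) (carrier G)"
    using has_sum_cross[OF bessel bessel_rep[OF y(1) k], of \<eta>] by simp
  then have "((\<lambda>g. \<pi> (inv k) (cinner \<eta> (\<pi> g \<eta>) *\<^sub>C \<pi> g (\<pi> k y))) has_sum \<pi> (inv k) (\<pi> k y)) (carrier G)"
    by (rule has_sum_bounded_linear[OF bounded_linear_rep[OF inv_closed[OF k]]])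
  then have "((\<lambda>g. \<pi> (inv k) (cinner \<eta> (\<pi> (k \<otimes> g \<otimes> inv k) \<eta>) *\<^sub>C \<pi> (k \<otimes> g \<otimes> inv k) (\<pi> k y)))
      has_sum y) (carrier G)"
    using k by (subst has_sum_reindex_bij_betw[OF bij_betw_conjugation[OF k]]) simp
  then show ?thesis
    by (rule iffD1[OF has_sum_cong, rotated]) (simp add: k rep_scaleC rep_mult)
qed

text \<open>The coefficient functions \<open>c\<close> that expand \<open>y\<close> along its orbit, together with all their
  conjugates, form a set to which averaging applies; it contains \<open>g \<mapsto> \<langle>\<eta>, \<pi> g \<eta>\<rangle>\<close> by
  \<open>extreme_bessel_conjugated_expansion\<close>. Averaging keeps the value \<open>\<langle>\<eta>, \<eta>\<rangle>\<close> at \<open>\<one>\<close> and makes the rest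
  of the expansion arbitrarily small, so \<open>y = (norm \<eta>)\<^sup>2 y\<close>.\<close>

lemma extreme_bessel_alternative:
  assumes icc: "\<And>g. g \<in> carrier G \<Longrightarrow> g \<noteq> \<one> \<Longrightarrow> infinite (conjugacy_class G g)"
    and ext: "extreme_bessel \<eta>" and y: "bessel y" "cross \<eta> \<eta> y = 0"
  shows "norm \<eta> = 1 \<or> y = 0"
proof -
  note bessel = extreme_besselD(1)[OF ext]
  define X where "X = {c. c \<one> = cinner \<eta> \<eta> \<and>
    (\<forall>F. finite F \<longrightarrow> F \<subseteq> carrier G \<longrightarrow> (\<Sum>g\<in>F. (cmod (c g))\<^sup>2) \<le> 1) \<and>
    (\<forall>k\<in>carrier G. ((\<lambda>g. c (k \<otimes> g \<otimes> inv k) *\<^sub>C \<pi> g y) has_sum y) (carrier G))}"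
  have X_one: "c \<one> = cinner \<eta> \<eta>"
    and X_sum: "finite F \<Longrightarrow> F \<subseteq> carrier G \<Longrightarrow> (\<Sum>g\<in>F. (cmod (c g))\<^sup>2) \<le> 1"
    and X_expansion: "k \<in> carrier G \<Longrightarrow>
      ((\<lambda>g. c (k \<otimes> g \<otimes> inv k) *\<^sub>C \<pi> g y) has_sum y) (carrier G)"
    if "c \<in> X" for c F k
    using that by (simp_all add: X_def)
  have bound: "(norm (y - cinner \<eta> \<eta> *\<^sub>C y))\<^sup>2 \<le> e" if "e > 0" for e
  proof -
    have "\<exists>c\<in>X. \<forall>F. finite F \<longrightarrow> F \<subseteq> carrier G - {\<one>} \<longrightarrow> (\<Sum>g\<in>F. (cmod (c g))\<^sup>2) \<le> e"
    proof (rule icc_average[where B = 1])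
      have "(\<Sum>g\<in>F. (cmod (cinner \<eta> (\<pi> g \<eta>)))\<^sup>2) \<le> 1" if "finite F" "F \<subseteq> carrier G" for F
      proof -
        have "(norm \<eta>)\<^sup>2 \<le> 1"
          using bessel_norm_le_1[OF bessel] by (simp add: power_le_one)
        then show ?thesis using bessel_sum_le[OF bessel that, of \<eta>] by linarith
      qed
      then have "(\<lambda>g. cinner \<eta> (\<pi> g \<eta>)) \<in> X"
        unfolding X_def using extreme_bessel_conjugated_expansion[OF ext y] by (simp add: rep_one)
      then show "X \<noteq> {}" by blast
    next
      fix c c' assume c: "c \<in> X" "c' \<in> X"
      show "(\<lambda>g. (c g + c' g) / 2) \<in> X"
        unfolding X_def mem_Collect_eq
      proof (intro conjI allI impI ballI)
        show "(c \<one> + c' \<one>) / 2 = cinner \<eta> \<eta>"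
          by (simp add: X_one c)
      next
        fix F assume F: "finite F" "F \<subseteq> carrier G"
        have le: "(cmod (c g + c' g))\<^sup>2 \<le> 2 * (cmod (c g))\<^sup>2 + 2 * (cmod (c' g))\<^sup>2" for g
          using parallelogram[of "c g" "c' g"] zero_le_power2[of "cmod (c g - c' g)"] by linarith
        have "(cmod ((c g + c' g) / 2))\<^sup>2 \<le> ((cmod (c g))\<^sup>2 + (cmod (c' g))\<^sup>2) / 2" for g
          using le[of g] by (simp add: norm_divide power_divide)
        then have "(\<Sum>g\<in>F. (cmod ((c g + c' g) / 2))\<^sup>2)
            \<le> (\<Sum>g\<in>F. ((cmod (c g))\<^sup>2 + (cmod (c' g))\<^sup>2) / 2)"
          by (rule sum_mono)
        also have "\<dots> = ((\<Sum>g\<in>F. (cmod (c g))\<^sup>2) + (\<Sum>g\<in>F. (cmod (c' g))\<^sup>2)) / 2"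
          by (simp add: sum.distrib flip: sum_divide_distrib)
        also have "\<dots> \<le> (1 + 1) / 2"
          by (intro divide_right_mono add_mono X_sum c F) simp
        finally show "(\<Sum>g\<in>F. (cmod ((c g + c' g) / 2))\<^sup>2) \<le> 1" by simp
      next
        fix k assume k: "k \<in> carrier G"
        have "((\<lambda>g. (1/2) *\<^sub>R (c (k \<otimes> g \<otimes> inv k) *\<^sub>C \<pi> g y + c' (k \<otimes> g \<otimes> inv k) *\<^sub>C \<pi> g y))
            has_sum (1/2) *\<^sub>R (y + y)) (carrier G)"
          by (intro has_sum_bounded_linear[OF bounded_linear_scaleR_right] has_sum_add X_expansion c k)
        then have "((\<lambda>g. (1/2) *\<^sub>R (c (k \<otimes> g \<otimes> inv k) *\<^sub>C \<pi> g y + c' (k \<otimes> g \<otimes> inv k) *\<^sub>C \<pi> g y))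
            has_sum y) (carrier G)"
          by (simp only: scaleR_half_double)
        then show "((\<lambda>g. ((c (k \<otimes> g \<otimes> inv k) + c' (k \<otimes> g \<otimes> inv k)) / 2) *\<^sub>C \<pi> g y) has_sum y) (carrier G)"
          by (simp add: scaleR_scaleC scaleC_scaleC scaleC_one flip: scaleC_add_left)
      qed
    next
      fix c k assume c: "c \<in> X" and k: "k \<in> carrier G"
      show "(\<lambda>g. c (k \<otimes> g \<otimes> inv k)) \<in> X"
        unfolding X_def mem_Collect_eq
      proof (intro conjI allI impI ballI)
        show "c (k \<otimes> \<one> \<otimes> inv k) = cinner \<eta> \<eta>"
          by (simp add: X_one c k)
      next
        fix F assume F: "finite F" "F \<subseteq> carrier G"
        have "(\<Sum>g\<in>F. (cmod (c (k \<otimes> g \<otimes> inv k)))\<^sup>2) = (\<Sum>g\<in>(\<lambda>g. k \<otimes> g \<otimes> inv k) ` F. (cmod (c g))\<^sup>2)"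
          using F(2) bij_betw_conjugation[OF k]
          by (subst sum.reindex) (auto simp: bij_betw_def intro: inj_on_subset)
        also have "\<dots> \<le> 1"
        proof -
          have "(\<lambda>g. k \<otimes> g \<otimes> inv k) ` F \<subseteq> carrier G" using k F(2) by auto
          then show ?thesis using F(1) by (intro X_sum c) auto
        qed
        finally show "(\<Sum>g\<in>F. (cmod (c (k \<otimes> g \<otimes> inv k)))\<^sup>2) \<le> 1" .
      next
        fix j assume j: "j \<in> carrier G"
        have "((\<lambda>g. c ((k \<otimes> j) \<otimes> g \<otimes> inv (k \<otimes> j)) *\<^sub>C \<pi> g y) has_sum y) (carrier G)"
          by (intro X_expansion c m_closed k j)
        then show "((\<lambda>g. c (k \<otimes> (j \<otimes> g \<otimes> inv j) \<otimes> inv k) *\<^sub>C \<pi> g y) has_sum y) (carrier G)"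
          by (rule iffD1[OF has_sum_cong, rotated]) (simp add: k j inv_mult_group m_assoc)
      qed
    qed (fact icc that X_sum)+
    then obtain c where c: "c \<in> X"
      and small: "\<forall>F. finite F \<longrightarrow> F \<subseteq> carrier G - {\<one>} \<longrightarrow> (\<Sum>g\<in>F. (cmod (c g))\<^sup>2) \<le> e"
      by blast
    have "((\<lambda>g. c (\<one> \<otimes> g \<otimes> inv \<one>) *\<^sub>C \<pi> g y) has_sum y) (carrier G)"
      by (intro X_expansion c one_closed)
    then have "((\<lambda>g. c g *\<^sub>C \<pi> g y) has_sum y) (carrier G)"
      by (simp cong: has_sum_cong)
    then have "((\<lambda>g. c g *\<^sub>C \<pi> g y) has_sum (y - (\<Sum>g\<in>{\<one>}. c g *\<^sub>C \<pi> g y))) (carrier G - {\<one>})"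
      by (intro has_sum_Diff has_sum_finite) auto
    moreover have "(\<Sum>g\<in>{\<one>}. c g *\<^sub>C \<pi> g y) = cinner \<eta> \<eta> *\<^sub>C y"
      by (simp add: X_one c rep_one)
    ultimately have "((\<lambda>g. c g *\<^sub>C \<pi> g y) has_sum (y - cinner \<eta> \<eta> *\<^sub>C y)) (carrier G - {\<one>})"
      by simp
    then show ?thesis
    proof (rule norm_sq_has_sum_le)
      fix F assume F: "finite F" "F \<subseteq> carrier G - {\<one>}"
      then have "(norm (\<Sum>g\<in>F. c g *\<^sub>C \<pi> g y))\<^sup>2 \<le> (\<Sum>g\<in>F. (cmod (c g))\<^sup>2)"
        using y(1) by (intro norm_sum_scaleC_sq_le bessel_sum_le) auto
      with small F show "(norm (\<Sum>g\<in>F. c g *\<^sub>C \<pi> g y))\<^sup>2 \<le> e" by fastforce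
    qed
  qed
  then have "(norm (y - cinner \<eta> \<eta> *\<^sub>C y))\<^sup>2 \<le> 0"
    using field_le_epsilon[of "(norm (y - cinner \<eta> \<eta> *\<^sub>C y))\<^sup>2" 0] by simp
  then have "y - cinner \<eta> \<eta> *\<^sub>C y = 0" by simp
  also have "y - cinner \<eta> \<eta> *\<^sub>C y = (1 - (norm \<eta>)\<^sup>2) *\<^sub>R y"
    by (simp add: cinner_self scaleR_diff_left) (simp add: scaleR_scaleC)
  finally have "(norm \<eta>)\<^sup>2 = 1 \<or> y = 0" by auto
  then show ?thesis by (simp add: power2_eq_1_iff) (metis norm_ge_zero not_one_le_zero neg_0_le_iff_le)
qed

end

section \<open>Dimension count\<close>

context unitary_rep
begin

lemma has_sum_coefficients_swap:
  "((\<lambda>g. (cmod (cinner u (\<pi> g w)))\<^sup>2) has_sum s) (carrier G) \<longleftrightarrow>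
   ((\<lambda>g. (cmod (cinner w (\<pi> g u)))\<^sup>2) has_sum s) (carrier G)"
proof -
  have "bij_betw (\<lambda>g. inv g) (carrier G) (carrier G)"
    by (rule bij_betwI[where g = "\<lambda>g. inv g"]) auto
  then have "((\<lambda>g. (cmod (cinner u (\<pi> g w)))\<^sup>2) has_sum s) (carrier G) \<longleftrightarrow>
      ((\<lambda>g. (cmod (cinner u (\<pi> (inv g) w)))\<^sup>2) has_sum s) (carrier G)"
    by (rule has_sum_reindex_bij_betw[symmetric])
  also have "\<dots> \<longleftrightarrow> ((\<lambda>g. (cmod (cinner w (\<pi> g u)))\<^sup>2) has_sum s) (carrier G)"
  proof (rule has_sum_cong)
    fix g assume "g \<in> carrier G"
    then have "cmod (cinner u (\<pi> (inv g) w)) = cmod (cinner (\<pi> g u) w)"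
      by (simp add: cinner_rep_left)
    also have "\<dots> = cmod (cinner w (\<pi> g u))"
      by (subst cinner_commute) simp
    finally show "(cmod (cinner u (\<pi> (inv g) w)))\<^sup>2 = (cmod (cinner w (\<pi> g u)))\<^sup>2"
      by simp
  qed
  finally show ?thesis .
qed

lemma exists_extreme_bessel:
  fixes V :: "'h set"
  assumes "countable V" "V \<noteq> {}" "\<And>z. (\<And>v. v \<in> V \<Longrightarrow> Re (cinner z v) = 0) \<Longrightarrow> z = 0"
  shows "\<exists>\<eta>. extreme_bessel \<eta>"
proof -
  have "\<exists>x\<in>{u. bessel u}. \<forall>z. x + z \<in> {u. bessel u} \<and> x - z \<in> {u. bessel u} \<longrightarrow> z = 0"
  proof (rule exists_extreme_point[where V = V])
    show "{u. bessel u} \<noteq> {}" using bessel_zero by blast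
    show "bounded {u. bessel u}" using bessel_norm_le_1 by (auto simp: bounded_iff)
  qed (simp_all add: closed_bessel bessel_midpoint assms)
  then show ?thesis by (auto simp: extreme_bessel_def)
qed

text \<open>The count: \<open>(\<Sum>i\<in>I. (norm (x i))\<^sup>2)\<close> is the dimension of the space relative to the regular
  representation, \<open>(norm \<eta>)\<^sup>2\<close> is that of the closed span of the orbit of \<open>\<eta>\<close>, and
  \<open>(\<Sum>i\<in>I. (norm (x i - cross \<eta> \<eta> (x i)))\<^sup>2)\<close> is that of its orthogonal complement. As the last
  two add up to \<open>1\<close>, either half of \<open>extreme_bessel_alternative\<close> implies the other: full
  dimension of the span, or vanishing of the complement.\<close>

lemma extreme_bessel_complete:
  assumes icc: "\<And>g. g \<in> carrier G \<Longrightarrow> g \<noteq> \<one> \<Longrightarrow> infinite (conjugacy_class G g)"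
    and ext: "extreme_bessel \<eta>"
    and x: "finite I" "\<And>i. i \<in> I \<Longrightarrow> bessel (x i)"
    and frame: "\<And>f. (norm f)\<^sup>2 = (\<Sum>i\<in>I. \<Sum>\<^sub>\<infinity>g\<in>carrier G. (cmod (cinner f (\<pi> g (x i))))\<^sup>2)"
    and dim: "(\<Sum>i\<in>I. (norm (x i))\<^sup>2) = 1"
  shows "norm \<eta> = 1" "cross \<eta> \<eta> f = f"
proof -
  let ?A = "cross \<eta> \<eta>"
  note bessel = extreme_besselD(1)[OF ext]
  note fixed = extreme_bessel_fixed[OF ext]
  note idem = cross_idem[OF bessel bessel fixed]
  interpret A: bounded_linear ?A by (rule bounded_linear_cross[OF bessel bessel])
  have alternative: "norm \<eta> = 1 \<or> x i - ?A (x i) = 0" if "i \<in> I" for i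
  proof -
    have "norm \<eta> = 1 \<or> (1/2) *\<^sub>R (x i - ?A (x i)) = 0"
    proof (rule extreme_bessel_alternative[OF icc ext])
      show "bessel ((1/2) *\<^sub>R (x i - ?A (x i)))"
        by (intro bessel_half_diff bessel_cross bessel x that)
      show "?A ((1/2) *\<^sub>R (x i - ?A (x i))) = 0"
        by (simp add: A.scaleR A.diff idem)
    qed
    then show ?thesis by simp
  qed
  have coeff: "(\<Sum>\<^sub>\<infinity>g\<in>carrier G. (cmod (cinner \<eta> (\<pi> g (x i))))\<^sup>2)
      = (norm (x i))\<^sup>2 - (norm (x i - ?A (x i)))\<^sup>2" for i
  proof -
    have "((\<lambda>g. (cmod (cinner \<eta> (\<pi> g (x i))))\<^sup>2) has_sum Re (cinner (?A (x i)) (x i))) (carrier G)"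
      by (subst has_sum_coefficients_swap) (rule has_sum_frame[OF bessel])
    moreover have "cinner (?A (x i)) (?A (x i)) = cinner (?A (x i)) (x i)"
      using idem by (simp add: cross_adjoint bessel)
    ultimately show ?thesis
      using Re_cinner_commute[of "x i" "?A (x i)"]
      by (simp add: infsumI norm_diff_sq norm_sq_eq_Re_cinner[of "?A (x i)"])
  qed
  have count: "(norm \<eta>)\<^sup>2 = 1 - (\<Sum>i\<in>I. (norm (x i - ?A (x i)))\<^sup>2)"
    using frame[of \<eta>] by (simp add: coeff sum_subtractf dim)
  show norm: "norm \<eta> = 1"
  proof (rule ccontr)
    assume "norm \<eta> \<noteq> 1"
    then have "(\<Sum>i\<in>I. (norm (x i - ?A (x i)))\<^sup>2) = 0"
      using alternative by (intro sum.neutral) auto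
    then have "(norm \<eta>)\<^sup>2 = 1" using count by simp
    then show False
      using \<open>norm \<eta> \<noteq> 1\<close> norm_ge_zero[of \<eta>] by (simp add: power2_eq_1_iff)
  qed
  have "(\<Sum>i\<in>I. (norm (x i - ?A (x i)))\<^sup>2) = 0"
    using count by (simp add: norm)
  then have Ax: "x i - ?A (x i) = 0" if "i \<in> I" for i
    using that x(1) by (simp add: sum_nonneg_eq_0_iff)
  have "cinner (f - ?A f) (\<pi> g (x i)) = 0" if "i \<in> I" "g \<in> carrier G" for i g
  proof -
    have "cinner (f - ?A f) (\<pi> g (x i)) = cinner f (\<pi> g (x i - ?A (x i)))"
      using that bessel by (simp add: cinner_simps cross_adjoint rep_diff rep_cross)
    then show ?thesis using that by (simp add: Ax rep_zero)
  qed
  then have "(norm (f - ?A f))\<^sup>2 = 0"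
    unfolding frame by (intro sum.neutral ballI infsum_0) simp
  then show "?A f = f" by simp
qed

text \<open>Orthonormality is the Bessel inequality for \<open>f = \<eta>\<close>: the coefficient at \<open>\<one>\<close> already exhausts
  the bound. Totality holds because the expansion along the orbit reproduces every vector.\<close>

lemma orthonormal_basis_orbit:
  assumes bessel: "bessel \<eta>" and norm: "norm \<eta> = 1" and total: "\<And>f. cross \<eta> \<eta> f = f"
  shows "orthonormal_basis (\<lambda>g. \<pi> g \<eta>) (carrier G)"
  unfolding orthonormal_basis_def
proof (intro conjI ballI)
  have self: "cinner \<eta> \<eta> = 1" by (simp add: cinner_self norm)
  have orth: "cinner \<eta> (\<pi> g \<eta>) = 0" if "g \<in> carrier G" "g \<noteq> \<one>" for g
  proof -
    have "(\<Sum>g\<in>{\<one>, g}. (cmod (cinner \<eta> (\<pi> g \<eta>)))\<^sup>2) \<le> 1"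
      using bessel_sum_le[OF bessel, of "{\<one>, g}" \<eta>] that by (simp add: norm)
    then show ?thesis using that by (simp add: rep_one self)
  qed
  fix g h assume gh: "g \<in> carrier G" "h \<in> carrier G"
  have "cinner (\<pi> g \<eta>) (\<pi> h \<eta>) = cinner \<eta> (\<pi> (inv g \<otimes> h) \<eta>)"
    using gh by (simp add: cinner_rep_left rep_mult)
  moreover have "inv g \<otimes> h = \<one> \<longleftrightarrow> g = h"
    by (metis gh inv_closed inv_equality inv_inv l_inv)
  ultimately show "cinner (\<pi> g \<eta>) (\<pi> h \<eta>) = (if g = h then 1 else 0)"
    using gh orth[of "inv g \<otimes> h"] by (auto simp: rep_one self)
next
  have "f \<in> closure (cspan ((\<lambda>g. \<pi> g \<eta>) ` carrier G))" for f
  proof (rule Lim_in_closed_set)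
    show "(sum (\<lambda>g. cinner f (\<pi> g \<eta>) *\<^sub>C \<pi> g \<eta>) \<longlongrightarrow> f) (finite_subsets_at_top (carrier G))"
      using has_sum_cross[OF bessel bessel, of f] by (simp add: total has_sum_def)
    have "(\<Sum>g\<in>F. cinner f (\<pi> g \<eta>) *\<^sub>C \<pi> g \<eta>) \<in> cspan ((\<lambda>g. \<pi> g \<eta>) ` carrier G)"
      if "F \<subseteq> carrier G" for F
      using that
      by (intro complex_vector.span_sum complex_vector.span_scale complex_vector.span_base) auto
    then show "\<forall>\<^sub>F F in finite_subsets_at_top (carrier G).
        (\<Sum>g\<in>F. cinner f (\<pi> g \<eta>) *\<^sub>C \<pi> g \<eta>) \<in> closure (cspan ((\<lambda>g. \<pi> g \<eta>) ` carrier G))"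
      using closure_subset by (intro eventually_finite_subsets_at_top_weakI) blast
  qed simp_all
  then show "closure (cspan ((\<lambda>g. \<pi> g \<eta>) ` carrier G)) = UNIV" by blast
qed

end

section \<open>Restriction to a subgroup of finite index\<close>

lemma (in group) has_sum_rcosets:
  fixes f :: "'a \<Rightarrow> 'c::topological_comm_monoid_add"
  assumes "subgroup H G" "finite (rcosets H)" "\<And>C. C \<in> rcosets H \<Longrightarrow> (f has_sum s C) C"
  shows "(f has_sum (\<Sum>C\<in>rcosets H. s C)) (carrier G)"
proof -
  have "(f has_sum (\<Sum>C\<in>rcosets H. s C)) (\<Union>C\<in>rcosets H. C)"
  proof (rule sum_has_sum[OF assms(2)])
    show "C \<inter> D = {}" if "C \<in> rcosets H" "D \<in> rcosets H" "C \<noteq> D" for C D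
      using rcos_disjoint[OF assms(1)] that by (auto simp: pairwise_def disjnt_def)
  qed (rule assms(3))
  then show ?thesis
    using rcosets_part_G[OF assms(1)] by simp
qed

lemma (in group) bij_betw_r_coset:
  assumes "subgroup H G" "r \<in> carrier G"
  shows "bij_betw (\<lambda>h. h \<otimes> r) H (H #> r)"
proof -
  have "inj_on (\<lambda>h. h \<otimes> r) H"
    using assms subgroup.mem_carrier[OF assms(1)] by (intro inj_onI) simp
  then show ?thesis by (auto simp: bij_betw_def r_coset_def)
qed

context unitary_rep
begin

lemma unitary_rep_subgroup:
  assumes "subgroup H G"
  shows "unitary_rep (G\<lparr>carrier := H\<rparr>) \<pi>"
proof (intro unitary_rep.intro unitary_rep_axioms.intro)
  show "group (G\<lparr>carrier := H\<rparr>)"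
    by (rule subgroup.subgroup_is_group[OF assms is_group])
  show "unitary_representation (G\<lparr>carrier := H\<rparr>) \<pi>"
    using unitary_representation subgroup.subset[OF assms]
    by (auto simp: unitary_representation_def hom_def)
qed

lemma bessel_subgroup:
  assumes "subgroup H G" "bessel u"
  shows "unitary_rep.bessel (G\<lparr>carrier := H\<rparr>) \<pi> u"
  using bessel_sum_le[OF assms(2)] subgroup.subset[OF assms(1)]
  by (simp add: unitary_rep.bessel_def[OF unitary_rep_subgroup[OF assms(1)]])

lemma has_sum_orbit_r_coset:
  assumes "subgroup H G" "r \<in> carrier G"
  shows "((\<lambda>h. (cmod (cinner f (\<pi> h (\<pi> r u))))\<^sup>2) has_sum s) H \<longleftrightarrow>
    ((\<lambda>g. (cmod (cinner f (\<pi> g u)))\<^sup>2) has_sum s) (H #> r)"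
proof -
  have "((\<lambda>h. (cmod (cinner f (\<pi> h (\<pi> r u))))\<^sup>2) has_sum s) H \<longleftrightarrow>
      ((\<lambda>h. (cmod (cinner f (\<pi> (h \<otimes> r) u)))\<^sup>2) has_sum s) H"
    using subgroup.mem_carrier[OF assms(1)] assms(2) by (intro has_sum_cong) (simp add: rep_mult)
  also have "\<dots> \<longleftrightarrow> ((\<lambda>g. (cmod (cinner f (\<pi> g u)))\<^sup>2) has_sum s) (H #> r)"
    by (rule has_sum_reindex_bij_betw[OF bij_betw_r_coset[OF assms]])
  finally show ?thesis .
qed

end

theorem proposition3p1:
  fixes G :: "('g, 'b) monoid_scheme"
    and H :: "'g set"
    and \<pi> :: "'g \<Rightarrow> 'h::chilbert_space \<Rightarrow> 'h"
    and \<xi> :: 'h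
    and N :: nat
  assumes "icc_group G"
    and "countable (carrier G)"
    and "unitary_representation G \<pi>"
    and "parseval_frame_vector G \<pi> \<xi>"
    and "N \<ge> 1"
    and "(norm \<xi>)\<^sup>2 = 1 / real N"
    and "subgroup H G"
    and "icc_group (G\<lparr>carrier := H\<rparr>)"
    and "card (rcosets\<^bsub>G\<^esub> H) = N"
  shows "\<exists>\<eta>. parseval_frame_vector G \<pi> \<eta> \<and>
    orthonormal_basis (\<lambda>h. sqrt (real N) *\<^sub>R \<pi> h \<eta>) H"
proof -
  interpret unitary_rep G \<pi>
    using assms(1,3) by (simp add: unitary_rep_def unitary_rep_axioms_def icc_group_def)
  let ?GH = "G\<lparr>carrier := H\<rparr>"
  interpret HR: unitary_rep ?GH \<pi>
    by (rule unitary_rep_subgroup[OF assms(7)])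
  note Hsub = subgroup.mem_carrier[OF assms(7)]
  have fin: "finite (rcosets\<^bsub>G\<^esub> H)"
    using assms(5,9) by (intro card_ge_0_finite) simp
  have frame: "((\<lambda>g. (cmod (cinner f (\<pi> g \<xi>)))\<^sup>2) has_sum (norm f)\<^sup>2) (carrier G)" for f
    using assms(4) by (simp add: parseval_frame_vector_def parseval_frame_def)
  have bessel_\<xi>: "bessel \<xi>"
    by (rule besselI_has_sum[OF frame]) simp
  define r where "r C = (SOME a. a \<in> carrier G \<and> C = H #>\<^bsub>G\<^esub> a)" for C
  have r: "r C \<in> carrier G \<and> C = H #>\<^bsub>G\<^esub> r C" if "C \<in> rcosets\<^bsub>G\<^esub> H" for C
    unfolding r_def by (rule someI_ex) (use that in \<open>auto simp: RCOSETS_def\<close>)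
  \<comment> \<open>Only real parts are maximised, so the multiples by \<open>\<i>\<close> are added to make \<open>V\<close> separating.\<close>
  define V where "V = (\<lambda>g. \<pi> g \<xi>) ` carrier G \<union> (\<lambda>g. \<i> *\<^sub>C \<pi> g \<xi>) ` carrier G"
  have "z = 0" if z: "\<And>v. v \<in> V \<Longrightarrow> Re (cinner z v) = 0" for z
  proof -
    have "cinner z (\<pi> g \<xi>) = 0" if "g \<in> carrier G" for g
      using z[of "\<pi> g \<xi>"] z[of "\<i> *\<^sub>C \<pi> g \<xi>"] that
      by (auto simp: V_def cinner_simps complex_eq_iff)
    then have "((\<lambda>g. (cmod (cinner z (\<pi> g \<xi>)))\<^sup>2) has_sum 0) (carrier G)"
      by (intro has_sum_0) simp
    then have "(norm z)\<^sup>2 = 0" by (rule has_sum_unique[OF frame])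
    then show ?thesis by simp
  qed
  then have "\<exists>\<eta>. HR.extreme_bessel \<eta>"
    using assms(2) by (intro HR.exists_extreme_bessel[of V]) (auto simp: V_def)
  then obtain \<eta> where ext: "HR.extreme_bessel \<eta>" by blast
  note bessel_\<eta> = HR.extreme_besselD(1)[OF ext]
  \<comment> \<open>The frame of \<open>\<xi>\<close> over \<open>G\<close> is cut into the \<open>H\<close>-orbits of the vectors \<open>\<pi> (r C) \<xi>\<close>.\<close>
  have frame_H: "(norm f)\<^sup>2 = (\<Sum>C\<in>rcosets\<^bsub>G\<^esub> H. \<Sum>\<^sub>\<infinity>h\<in>carrier ?GH. (cmod (cinner f (\<pi> h (\<pi> (r C) \<xi>))))\<^sup>2)" for f
  proof (rule has_sum_unique[OF frame])
    show "((\<lambda>g. (cmod (cinner f (\<pi> g \<xi>)))\<^sup>2) has_sum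
        (\<Sum>C\<in>rcosets\<^bsub>G\<^esub> H. \<Sum>\<^sub>\<infinity>h\<in>carrier ?GH. (cmod (cinner f (\<pi> h (\<pi> (r C) \<xi>))))\<^sup>2)) (carrier G)"
    proof (rule has_sum_rcosets[OF assms(7) fin])
      fix C assume C: "C \<in> rcosets\<^bsub>G\<^esub> H"
      have "HR.bessel (\<pi> (r C) \<xi>)"
        using C r by (intro bessel_subgroup bessel_rep bessel_\<xi> assms(7)) blast
      from has_sum_infsum[OF HR.bessel_summable[OF this]]
      show "((\<lambda>g. (cmod (cinner f (\<pi> g \<xi>)))\<^sup>2) has_sum
          (\<Sum>\<^sub>\<infinity>h\<in>carrier ?GH. (cmod (cinner f (\<pi> h (\<pi> (r C) \<xi>))))\<^sup>2)) C"
        using has_sum_orbit_r_coset[OF assms(7), of "r C"] r[OF C] by simp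
    qed
  qed
  have dim: "(\<Sum>C\<in>rcosets\<^bsub>G\<^esub> H. (norm (\<pi> (r C) \<xi>))\<^sup>2) = 1"
    using r assms(5,6,9) by (simp add: norm_rep)
  have icc_H: "infinite (conjugacy_class ?GH g)" if "g \<in> carrier ?GH" "g \<noteq> \<one>\<^bsub>?GH\<^esub>" for g
    using assms(8) that unfolding icc_group_def by blast
  have bessel_r: "HR.bessel (\<pi> (r C) \<xi>)" if "C \<in> rcosets\<^bsub>G\<^esub> H" for C
    using that r by (intro bessel_subgroup bessel_rep bessel_\<xi> assms(7)) blast
  have norm_\<eta>: "norm \<eta> = 1" and total: "HR.cross \<eta> \<eta> f = f" for f
    by (rule HR.extreme_bessel_complete[where x = "\<lambda>C. \<pi> (r C) \<xi>" and I = "rcosets\<^bsub>G\<^esub> H"];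
      fact icc_H ext fin bessel_r frame_H dim)+
  define \<eta>' where "\<eta>' = (1 / sqrt (real N)) *\<^sub>R \<eta>"
  have "parseval_frame_vector G \<pi> \<eta>'"
    unfolding parseval_frame_vector_def parseval_frame_def
  proof
    fix f
    \<comment> \<open>The orbit of \<open>\<eta>\<close> splits along left cosets; exchanging \<open>f\<close> and \<open>\<eta>\<close> inverts the group elements and turns them into right cosets.\<close>
    have "((\<lambda>g. (cmod (cinner \<eta> (\<pi> g f)))\<^sup>2) has_sum (\<Sum>C\<in>rcosets\<^bsub>G\<^esub> H. (norm f)\<^sup>2)) (carrier G)"
    proof (rule has_sum_rcosets[OF assms(7) fin])
      fix C assume C: "C \<in> rcosets\<^bsub>G\<^esub> H"
      have "((\<lambda>h. (cmod (cinner (\<pi> (r C) f) (\<pi> h \<eta>)))\<^sup>2) has_sum (norm f)\<^sup>2) (carrier ?GH)"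
        using HR.has_sum_frame[OF bessel_\<eta>, of "\<pi> (r C) f"] r[OF C]
        by (simp add: total norm_rep flip: norm_sq_eq_Re_cinner)
      then have "((\<lambda>h. (cmod (cinner \<eta> (\<pi> h (\<pi> (r C) f))))\<^sup>2) has_sum (norm f)\<^sup>2) (carrier ?GH)"
        by (subst HR.has_sum_coefficients_swap)
      then show "((\<lambda>g. (cmod (cinner \<eta> (\<pi> g f)))\<^sup>2) has_sum (norm f)\<^sup>2) C"
        using has_sum_orbit_r_coset[OF assms(7), of "r C"] r[OF C] by simp
    qed
    then have "((\<lambda>g. (cmod (cinner f (\<pi> g \<eta>)))\<^sup>2) has_sum real N * (norm f)\<^sup>2) (carrier G)"
      by (subst has_sum_coefficients_swap) (simp add: assms(9))
    from has_sum_cmult_right[OF this, of "1 / real N"]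
    have "((\<lambda>g. 1 / real N * (cmod (cinner f (\<pi> g \<eta>)))\<^sup>2) has_sum (norm f)\<^sup>2) (carrier G)"
      using assms(5) by simp
    then show "((\<lambda>g. (cmod (cinner f (\<pi> g \<eta>')))\<^sup>2) has_sum (norm f)\<^sup>2) (carrier G)"
      by (rule iffD1[OF has_sum_cong, rotated])
        (simp add: \<eta>'_def rep_scaleR cinner_simps norm_mult norm_divide power_mult_distrib power_divide)
  qed
  moreover have "sqrt (real N) *\<^sub>R \<pi> h \<eta>' = \<pi> h \<eta>" if "h \<in> H" for h
    using that assms(5) Hsub by (simp add: \<eta>'_def rep_scaleR)
  then have "orthonormal_basis (\<lambda>h. sqrt (real N) *\<^sub>R \<pi> h \<eta>') H"
    using HR.orthonormal_basis_orbit[OF bessel_\<eta> norm_\<eta> total]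
    by (simp add: orthonormal_basis_def cong: image_cong)
  ultimately show ?thesis by blast
qed

end
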